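(* Let $T$ be a tree with edge lengths $\ell\colon E(T)\to\mathbb{R}_{>0}$ and let $\varphi(x)=x/\alpha-\beta$ with $\alpha\ge1$, $\beta\ge0$. An optimal solution of the problem Contraction on the instance $(T,\ell,\varphi)$ can be computed in time $O(n^3)$, where $n$ is the number of vertices of $T$.
   Context: For a graph $G=(V,E)$ with edge lengths $\ell\colon E\to\mathbb{R}_{>0}$ and $C\subseteq E$: $\ell_C$ equals $0$ on $C$ and $\ell$ elsewhere; $\mathrm{dist}_\ell$ is shortest-path distance. $C$ is a $\varphi$-contraction if $\mathrm{dist}_{\ell_C}(u,v)\ge\varphi(\mathrm{dist}_\ell(u,v))$ for all $u,v\in V$. The problem Contraction on $(G,\ell,\varphi)$ asks for a $\varphi$-contraction $C$ maximizing $\Phi(C)=m(G)-m(G/C)$, where $G/C$ is the simple graph obtained by contracting $C$, deleting loops and keeping one edge among parallel edges; on a tree $\Phi(C)=|C|$. *)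

theory Defs
  imports Complex_Main "HOL-Library.Landau_Symbols"
begin

section \<open>Graphs with edge lengths and contractions\<close>

text \<open>Undirected simple graphs are given by a vertex set \<open>V\<close> and a set \<open>E\<close> of two-element
  subsets of \<open>V\<close>; paths are nonempty lists of pairwise distinct vertices.\<close>

definition simple_graph :: "'v set \<Rightarrow> 'v set set \<Rightarrow> bool" where
  "simple_graph V E \<longleftrightarrow> finite V \<and> (\<forall>e\<in>E. \<exists>u\<in>V. \<exists>v\<in>V. u \<noteq> v \<and> e = {u, v})"

definition is_path :: "'v set \<Rightarrow> 'v set set \<Rightarrow> 'v list \<Rightarrow> bool" where
  "is_path V E p \<longleftrightarrow>
     p \<noteq> [] \<and> distinct p \<and> set p \<subseteq> V \<and> successively (\<lambda>u v. {u, v} \<in> E) p"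

definition paths_between :: "'v set \<Rightarrow> 'v set set \<Rightarrow> 'v \<Rightarrow> 'v \<Rightarrow> 'v list set" where
  "paths_between V E u v = {p. is_path V E p \<and> hd p = u \<and> last p = v}"

definition is_connected :: "'v set \<Rightarrow> 'v set set \<Rightarrow> bool" where
  "is_connected V E \<longleftrightarrow> V \<noteq> {} \<and> (\<forall>u\<in>V. \<forall>v\<in>V. paths_between V E u v \<noteq> {})"

definition has_cycle :: "'v set \<Rightarrow> 'v set set \<Rightarrow> bool" where
  "has_cycle V E \<longleftrightarrow> (\<exists>p. is_path V E p \<and> 3 \<le> length p \<and> {last p, hd p} \<in> E)"

definition is_tree :: "'v set \<Rightarrow> 'v set set \<Rightarrow> bool" where
  "is_tree V E \<longleftrightarrow> simple_graph V E \<and> is_connected V E \<and> \<not> has_cycle V E"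

definition path_length :: "('v set \<Rightarrow> real) \<Rightarrow> 'v list \<Rightarrow> real" where
  "path_length len p = (\<Sum>(u, v) \<leftarrow> zip p (tl p). len {u, v})"

text \<open>For nonnegative lengths a shortest walk may be taken to be a path. The value is
  meaningful only if \<open>u\<close> and \<open>v\<close> lie in the same connected component.\<close>

definition graph_dist :: "'v set \<Rightarrow> 'v set set \<Rightarrow> ('v set \<Rightarrow> real) \<Rightarrow> 'v \<Rightarrow> 'v \<Rightarrow> real" where
  "graph_dist V E len u v = (INF p \<in> paths_between V E u v. path_length len p)"

definition zero_on :: "'v set set \<Rightarrow> ('v set \<Rightarrow> real) \<Rightarrow> 'v set \<Rightarrow> real" where
  "zero_on C len e = (if e \<in> C then 0 else len e)"

definition is_contraction ::
  "(real \<Rightarrow> real) \<Rightarrow> 'v set \<Rightarrow> 'v set set \<Rightarrow> ('v set \<Rightarrow> real) \<Rightarrow> 'v set set \<Rightarrow> bool" where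
  "is_contraction \<phi> V E len C \<longleftrightarrow> C \<subseteq> E \<and>
     (\<forall>u\<in>V. \<forall>v\<in>V. graph_dist V E (zero_on C len) u v \<ge> \<phi> (graph_dist V E len u v))"

text \<open>The vertices of \<open>G/C\<close> are the connected components of \<open>(V, C)\<close>. Since its edges form a
  set of two-element sets of components, parallel edges are identified.\<close>

definition component :: "'v set set \<Rightarrow> 'v \<Rightarrow> 'v set" where
  "component C u = {(x, y). {x, y} \<in> C}\<^sup>* `` {u}"

definition quotient_edges :: "'v set set \<Rightarrow> 'v set set \<Rightarrow> 'v set set set" where
  "quotient_edges E C =
     {{component C u, component C v} | u v. {u, v} \<in> E \<and> component C u \<noteq> component C v}"

definition contraction_value :: "'v set set \<Rightarrow> 'v set set \<Rightarrow> int" where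
  "contraction_value E C = int (card E) - int (card (quotient_edges E C))"

definition optimal_contraction ::
  "(real \<Rightarrow> real) \<Rightarrow> 'v set \<Rightarrow> 'v set set \<Rightarrow> ('v set \<Rightarrow> real) \<Rightarrow> 'v set set \<Rightarrow> bool" where
  "optimal_contraction \<phi> V E len C \<longleftrightarrow> is_contraction \<phi> V E len C \<and>
     (\<forall>C'. is_contraction \<phi> V E len C' \<longrightarrow> contraction_value E C' \<le> contraction_value E C)"


section \<open>A real random access machine\<close>

text \<open>Programs operate on named arrays of natural numbers and named arrays of real numbers;
  a scalar variable is cell 0 of an array. A program mentions only finitely many arrays.

  To keep unit costs realistic, natural numbers can only be added, subtracted (truncated at 0)
  and compared, reals are subject to exact field arithmetic and comparison, and there is no
  conversion between the two sorts (in particular no rounding). The only real constants are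
  0 and 1, so that no information can be hidden in a program constant. Division by 0 yields 0.\<close>

record state =
  nats :: "string \<Rightarrow> nat \<Rightarrow> nat"
  reals :: "string \<Rightarrow> nat \<Rightarrow> real"

datatype nexp =
    NConst nat
  | NRead string nexp
  | NAdd nexp nexp
  | NSub nexp nexp

datatype rexp =
    RZero
  | ROne
  | RRead string nexp
  | RAdd rexp rexp
  | RSub rexp rexp
  | RMul rexp rexp
  | RDiv rexp rexp

datatype bexp =
    NLess nexp nexp
  | RLess rexp rexp
  | Neg bexp
  | Conj bexp bexp

datatype com =
    Skip
  | NWrite string nexp nexp
  | RWrite string nexp rexp
  | Seq com com
  | Cond bexp com com
  | Loop bexp com

primrec nval :: "nexp \<Rightarrow> state \<Rightarrow> nat" where
  "nval (NConst k) s = k"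
| "nval (NRead a i) s = nats s a (nval i s)"
| "nval (NAdd x y) s = nval x s + nval y s"
| "nval (NSub x y) s = nval x s - nval y s"

primrec rval :: "rexp \<Rightarrow> state \<Rightarrow> real" where
  "rval RZero s = 0"
| "rval ROne s = 1"
| "rval (RRead a i) s = reals s a (nval i s)"
| "rval (RAdd x y) s = rval x s + rval y s"
| "rval (RSub x y) s = rval x s - rval y s"
| "rval (RMul x y) s = rval x s * rval y s"
| "rval (RDiv x y) s = rval x s / rval y s"

primrec bval :: "bexp \<Rightarrow> state \<Rightarrow> bool" where
  "bval (NLess x y) s \<longleftrightarrow> nval x s < nval y s"
| "bval (RLess x y) s \<longleftrightarrow> rval x s < rval y s"
| "bval (Neg b) s \<longleftrightarrow> \<not> bval b s"
| "bval (Conj b c) s \<longleftrightarrow> bval b s \<and> bval c s"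

text \<open>Every constant, memory access, arithmetic operation, comparison and connective costs one
  step.\<close>

primrec ncost :: "nexp \<Rightarrow> nat" where
  "ncost (NConst k) = 1"
| "ncost (NRead a i) = ncost i + 1"
| "ncost (NAdd x y) = ncost x + ncost y + 1"
| "ncost (NSub x y) = ncost x + ncost y + 1"

primrec rcost :: "rexp \<Rightarrow> nat" where
  "rcost RZero = 1"
| "rcost ROne = 1"
| "rcost (RRead a i) = ncost i + 1"
| "rcost (RAdd x y) = rcost x + rcost y + 1"
| "rcost (RSub x y) = rcost x + rcost y + 1"
| "rcost (RMul x y) = rcost x + rcost y + 1"
| "rcost (RDiv x y) = rcost x + rcost y + 1"

primrec bcost :: "bexp \<Rightarrow> nat" where
  "bcost (NLess x y) = ncost x + ncost y + 1"
| "bcost (RLess x y) = rcost x + rcost y + 1"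
| "bcost (Neg b) = bcost b + 1"
| "bcost (Conj b c) = bcost b + bcost c + 1"

definition nwrite :: "string \<Rightarrow> nat \<Rightarrow> nat \<Rightarrow> state \<Rightarrow> state" where
  "nwrite a i k s = s\<lparr>nats := (nats s)(a := (nats s a)(i := k))\<rparr>"

definition rwrite :: "string \<Rightarrow> nat \<Rightarrow> real \<Rightarrow> state \<Rightarrow> state" where
  "rwrite a i x s = s\<lparr>reals := (reals s)(a := (reals s a)(i := x))\<rparr>"

text \<open>\<open>runs P s t s'\<close>: started in state \<open>s\<close>, program \<open>P\<close> halts in state \<open>s'\<close> after exactly \<open>t\<close>
  steps.\<close>

inductive runs :: "com \<Rightarrow> state \<Rightarrow> nat \<Rightarrow> state \<Rightarrow> bool" where
  Skip: "runs Skip s 1 s"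
| NWrite: "runs (NWrite a i x) s (ncost i + ncost x + 1) (nwrite a (nval i s) (nval x s) s)"
| RWrite: "runs (RWrite a i x) s (ncost i + rcost x + 1) (rwrite a (nval i s) (rval x s) s)"
| Seq: "\<lbrakk> runs P s t s'; runs Q s' t' s'' \<rbrakk> \<Longrightarrow> runs (Seq P Q) s (t + t') s''"
| CondTrue: "\<lbrakk> bval b s; runs P s t s' \<rbrakk> \<Longrightarrow> runs (Cond b P Q) s (bcost b + 1 + t) s'"
| CondFalse: "\<lbrakk> \<not> bval b s; runs Q s t s' \<rbrakk> \<Longrightarrow> runs (Cond b P Q) s (bcost b + 1 + t) s'"
| LoopFalse: "\<not> bval b s \<Longrightarrow> runs (Loop b P) s (bcost b + 1) s"
| LoopTrue: "\<lbrakk> bval b s; runs P s t s'; runs (Loop b P) s' t' s'' \<rbrakk>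
    \<Longrightarrow> runs (Loop b P) s (bcost b + 1 + t + t') s''"


section \<open>Instances in memory\<close>

text \<open>A graph on the vertices \<open>0, \<dots>, n - 1\<close> is presented by a list of its edges, in arbitrary
  order and with arbitrarily ordered end points.\<close>

definition edge_of :: "nat \<times> nat \<Rightarrow> nat set" where
  "edge_of p = {fst p, snd p}"

definition enumerates_edges :: "(nat \<times> nat) list \<Rightarrow> nat set set \<Rightarrow> bool" where
  "enumerates_edges es E \<longleftrightarrow> distinct (map edge_of es) \<and> set (map edge_of es) = E"

definition input_state ::
  "nat \<Rightarrow> (nat \<times> nat) list \<Rightarrow> (nat set \<Rightarrow> real) \<Rightarrow> real \<Rightarrow> real \<Rightarrow> state" where
  "input_state n es len \<alpha> \<beta> =
    \<lparr> nats = (\<lambda>a i.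
        if a = ''n'' \<and> i = 0 then n
        else if a = ''m'' \<and> i = 0 then length es
        else if a = ''src'' \<and> i < length es then fst (es ! i)
        else if a = ''dst'' \<and> i < length es then snd (es ! i)
        else 0),
      reals = (\<lambda>a i.
        if a = ''alpha'' \<and> i = 0 then \<alpha>
        else if a = ''beta'' \<and> i = 0 then \<beta>
        else if a = ''len'' \<and> i < length es then len (edge_of (es ! i))
        else 0) \<rparr>"

definition output_edges :: "(nat \<times> nat) list \<Rightarrow> state \<Rightarrow> nat set set" where
  "output_edges es s = {edge_of (es ! i) | i. i < length es \<and> nats s ''out'' i \<noteq> 0}"

end

theory Submission
  imports Defs
begin

text \<open>Charge an edge \<open>e\<close> with \<open>len e / \<alpha>\<close> if it is contracted and with \<open>len e / \<alpha> - len e\<close> otherwise.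
  Then a set of edges is a contraction iff no path has charge more than \<open>\<beta>\<close>. If the leaves of a
  rooted tree are absorbed into their parents one by one, only the largest charge \<open>D v \<ge> 0\<close> of a path
  from \<open>v\<close> into the part absorbed by \<open>v\<close> matters: absorbing \<open>c\<close> into \<open>p\<close> along \<open>e\<close> requires
  \<open>D p + D c + charge e \<le> \<beta>\<close> and turns \<open>D p\<close> into the maximum of \<open>D p\<close> and \<open>D c + charge e\<close>. Both the
  condition and the new value are monotone in \<open>D p\<close> and \<open>D c\<close>, so it suffices to store, for every
  vertex and every number of contracted edges, a partial solution with the least \<open>D\<close>. Each of the
  \<open>n - 1\<close> absorptions combines two rows of length \<open>n\<close> and copies \<open>n\<close> solutions, in time \<open>O(n\<^sup>2)\<close>.\<close>

section \<open>Trees grown from a root\<close>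

text \<open>The objective on a tree is a cardinality, whereas the constraint is real-valued. A table
  indexed by the constraint value would not be finite, so the roles are exchanged: the cardinality
  is the index and the charge is what is minimised. An uncontracted edge has charge at most 0 and a
  contracted one positive charge, so charges may rise and fall along a path; \<open>D v\<close> is
  nonnegative because the one-vertex path counts. An impossible entry is marked by \<beta> + 1, as
  the machine has no infinity. Because of the negative charges such a marker could slip below
  \<beta> after an addition, so it has to be tested for explicitly. The sets of all partial
  solutions occur only in invariants; the program is verified against a statement about table
  entries alone. The running time is read off the syntax: no loop makes more than \<open>n\<close>
  iterations, and loops are nested three deep.\<close>

definition verts :: "'v \<Rightarrow> ('v \<times> 'v) list \<Rightarrow> 'v set" where
  "verts r xs = insert r (snd ` set xs)"

definition edges :: "('v \<times> 'v) list \<Rightarrow> 'v set set" where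
  "edges xs = (\<lambda>(p, c). {p, c}) ` set xs"

text \<open>The newest pair stands at the head, so its child is a leaf of the whole tree. Induction
  on the list thus removes leaves in the very order in which they are absorbed.\<close>

fun grown :: "'v \<Rightarrow> ('v \<times> 'v) list \<Rightarrow> bool" where
  "grown r [] \<longleftrightarrow> True"
| "grown r ((p, c) # xs) \<longleftrightarrow> p \<in> verts r xs \<and> c \<notin> verts r xs \<and> grown r xs"

text \<open>A structural recursion in place of an infimum over paths. It makes sense for every real
  weight and is later applied to charges, which may be negative.\<close>

fun tree_dist :: "('v set \<Rightarrow> real) \<Rightarrow> ('v \<times> 'v) list \<Rightarrow> 'v \<Rightarrow> 'v \<Rightarrow> real" where
  "tree_dist len [] u v = 0"
| "tree_dist len ((p, c) # xs) u v =
    (if u = c then if v = c then 0 else len {p, c} + tree_dist len xs p v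
     else if v = c then tree_dist len xs u p + len {p, c}
     else tree_dist len xs u v)"

lemma verts_simps [simp]:
  "verts r [] = {r}"
  "verts r ((p, c) # xs) = insert c (verts r xs)"
  by (auto simp: verts_def)

lemma edges_simps [simp]:
  "edges [] = {}"
  "edges ((p, c) # xs) = insert {p, c} (edges xs)"
  by (auto simp: edges_def)

lemma finite_verts [simp]: "finite (verts r xs)"
  by (simp add: verts_def)

lemma finite_edges [simp]: "finite (edges xs)"
  by (simp add: edges_def)

lemma root_in_verts [simp]: "r \<in> verts r xs"
  by (simp add: verts_def)

lemma grown_edge_subset:
  assumes "grown r xs" "e \<in> edges xs"
  shows "e \<subseteq> verts r xs"
  using assms by (induction xs rule: grown.induct) auto

lemma card_verts:
  assumes "grown r xs"
  shows "card (verts r xs) = Suc (length xs)"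
  using assms by (induction xs rule: grown.induct) auto

lemma card_edges_le: "card (edges xs) \<le> length xs"
  unfolding edges_def by (rule le_trans[OF card_image_le]) (auto simp: card_length)

lemma is_path_mono:
  assumes "is_path V E p" "V \<subseteq> V'" "E \<subseteq> E'"
  shows "is_path V' E' p"
  using assms unfolding is_path_def by (auto intro: successively_mono)

lemma is_path_Cons:
  "is_path V E (x # y # zs) \<longleftrightarrow>
     x \<in> V \<and> x \<notin> set (y # zs) \<and> {x, y} \<in> E \<and> is_path V E (y # zs)"
  by (auto simp: is_path_def)

lemma is_path_rev [simp]: "is_path V E (rev p) \<longleftrightarrow> is_path V E p"
proof -
  have "successively (\<lambda>u v. {u, v} \<in> E) (rev p) \<longleftrightarrow> successively (\<lambda>u v. {u, v} \<in> E) p"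
    by (subst successively_rev) (simp add: insert_commute)
  then show ?thesis by (simp add: is_path_def)
qed

lemma grown_path_ex:
  assumes "grown r xs" "u \<in> verts r xs" "v \<in> verts r xs"
  shows "\<exists>p. is_path (verts r xs) (edges xs) p \<and> hd p = u \<and> last p = v"
  using assms
proof (induction r xs arbitrary: u v rule: grown.induct)
  case (1 r)
  then show ?case by (intro exI[of _ "[r]"]) (auto simp: is_path_def)
next
  case (2 r p c xs)
  let ?V = "verts r ((p, c) # xs)" and ?E = "edges ((p, c) # xs)"
  have step: "\<exists>q. is_path ?V ?E q \<and> hd q = c \<and> last q = w" if "w \<in> ?V" for w
  proof (cases "w = c")
    case True
    then show ?thesis by (intro exI[of _ "[c]"]) (auto simp: is_path_def)
  next
    case False
    with 2 that obtain q where q: "is_path (verts r xs) (edges xs) q" "hd q = p" "last q = w"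
      by auto
    then obtain q' where q': "q = p # q'" by (cases q) (auto simp: is_path_def)
    have "c \<notin> set q" using q(1) 2(2) by (auto simp: is_path_def)
    moreover have "is_path ?V ?E q" using q(1) by (rule is_path_mono) auto
    ultimately have "is_path ?V ?E (c # q)"
      unfolding q' by (subst is_path_Cons) (auto simp: insert_commute)
    then show ?thesis using q q' by (intro exI[of _ "c # q"]) auto
  qed
  consider (hd) "u = c" | (last) "v = c" | (old) "u \<in> verts r xs" "v \<in> verts r xs"
    using 2(3,4) by auto
  then show ?case
  proof cases
    case hd
    then show ?thesis using step[OF 2(4)] by simp
  next
    case last
    obtain q where q: "is_path ?V ?E q" "hd q = c" "last q = u" using step[OF 2(3)] by blast
    moreover have "q \<noteq> []" using q by (auto simp: is_path_def)
    ultimately show ?thesis using last by (intro exI[of _ "rev q"]) (auto simp: hd_rev last_rev)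
  next
    case old
    then obtain q where q: "is_path (verts r xs) (edges xs) q" "hd q = u" "last q = v"
      using "2.IH" 2(2) by auto
    have "is_path ?V ?E q" using q(1) by (rule is_path_mono) auto
    then show ?thesis using q by blast
  qed
qed

section \<open>Spanning a tree by growing, and the number of its edges\<close>

lemma crossing_edge_ex:
  assumes "is_connected V E" "S \<subseteq> V" "S \<noteq> {}" "S \<noteq> V"
  shows "\<exists>u v. u \<in> S \<and> v \<in> V \<and> v \<notin> S \<and> {u, v} \<in> E"
proof -
  obtain s t where st: "s \<in> S" "t \<in> V" "t \<notin> S" using assms by auto
  then have "paths_between V E s t \<noteq> {}"
    using assms by (auto simp: is_connected_def)
  then obtain p where p: "is_path V E p" "hd p = s" "last p = t"
    by (auto simp: paths_between_def)
  have "hd p \<in> S \<Longrightarrow> last p \<notin> S \<Longrightarrow> is_path V E p \<Longrightarrow> ?thesis" for p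
  proof (induction p)
    case (Cons x q)
    then show ?case
      by (cases q; cases "hd q \<in> S") (auto simp: is_path_Cons, auto simp: is_path_def)
  qed (simp add: is_path_def)
  then show ?thesis using p st by blast
qed

text \<open>A missing edge would close a cycle with the grown path between its ends. That path has
  at least three vertices, since otherwise the ends would coincide or the edge would already be
  grown.\<close>

lemma grown_spanning:
  assumes "is_tree V E" "grown r xs" "verts r xs = V" "edges xs \<subseteq> E"
  shows "edges xs = E"
proof (rule ccontr)
  assume "edges xs \<noteq> E"
  then obtain e where e: "e \<in> E" "e \<notin> edges xs" using assms by auto
  then obtain u v where uv: "u \<in> V" "v \<in> V" "u \<noteq> v" "e = {u, v}"
    using assms(1) by (fastforce simp: is_tree_def simple_graph_def)
  obtain p where p: "is_path V (edges xs) p" "hd p = u" "last p = v"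
    using grown_path_ex[OF assms(2)] uv assms(3) by blast
  have "3 \<le> length p"
  proof (rule ccontr)
    assume "\<not> 3 \<le> length p"
    then obtain "length p = 0 \<or> length p = 1 \<or> length p = 2" by linarith
    then show False using p uv e
      by (auto simp: is_path_def length_Suc_conv numeral_2_eq_2)
  qed
  moreover have "is_path V E p" using p(1) by (rule is_path_mono) (use assms in auto)
  moreover have "{last p, hd p} \<in> E" using p e uv by (simp add: insert_commute)
  ultimately have "has_cycle V E" by (auto simp: has_cycle_def)
  then show False using assms by (simp add: is_tree_def)
qed

text \<open>Growing continues until every vertex is reached, with one edge per vertex other than the
  root. The bound makes a loop over the edges a loop of at most \<open>n\<close> iterations, and
  makes \<open>n\<close> cardinalities per vertex enough.\<close>

lemma tree_card_edges:
  assumes "is_tree V E"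
  shows "Suc (card E) \<le> card V"
proof -
  have fin: "finite V" and con: "is_connected V E"
    using assms by (auto simp: is_tree_def simple_graph_def)
  then obtain r where r: "r \<in> V" by (auto simp: is_connected_def)
  have "\<exists>xs. grown r xs \<and> verts r xs \<subseteq> V \<and> edges xs \<subseteq> E \<and> length xs = k" if "k < card V" for k
    using that
  proof (induction k)
    case 0
    then show ?case using r by auto
  next
    case (Suc k)
    then obtain xs where xs: "grown r xs" "verts r xs \<subseteq> V" "edges xs \<subseteq> E" "length xs = k" by auto
    then have "verts r xs \<noteq> V" using card_verts[of r xs] Suc by auto
    then obtain u v where "u \<in> verts r xs" "v \<in> V" "v \<notin> verts r xs" "{u, v} \<in> E"
      using crossing_edge_ex[OF con xs(2)] root_in_verts by (metis empty_iff)
    then show ?case using xs by (intro exI[of _ "(u, v) # xs"]) auto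
  qed
  moreover have "card V \<noteq> 0" using fin r by auto
  ultimately obtain xs where xs: "grown r xs" "verts r xs \<subseteq> V" "edges xs \<subseteq> E"
      "length xs = card V - 1" by (metis diff_less less_one neq0_conv)
  then have "verts r xs = V" using card_verts[of r xs] fin \<open>card V \<noteq> 0\<close>
    by (intro card_subset_eq) auto
  then have "E = edges xs" using grown_spanning assms xs by metis
  then show ?thesis using card_edges_le[of xs] xs(4) \<open>card V \<noteq> 0\<close> by simp
qed

section \<open>Distances in a tree\<close>

lemma path_length_Cons [simp]:
  "path_length len [x] = 0"
  "path_length len (x # y # zs) = len {x, y} + path_length len (y # zs)"
  by (simp_all add: path_length_def)

lemma path_length_snoc:
  "p \<noteq> [] \<Longrightarrow> path_length len (p @ [x]) = path_length len p + len {last p, x}"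
proof (induction p)
  case (Cons y q)
  then show ?case by (cases q) auto
qed simp

lemma tree_dist_same [simp]: "tree_dist len xs u u = 0"
  by (induction len xs u u rule: tree_dist.induct) auto

lemma leaf_edge:
  assumes "grown r ((p, c) # xs)" "{c, y} \<in> edges ((p, c) # xs)"
  shows "y = p"
  using assms grown_edge_subset[of r xs "{c, y}"] by (auto simp: doubleton_eq_iff)

text \<open>The only neighbour of \<open>c\<close> is \<open>p\<close>, so an inner occurrence of
  \<open>c\<close> would have \<open>p\<close> on both sides, which distinctness forbids.\<close>

lemma path_avoids_leaf:
  assumes "grown r ((p, c) # xs)" "is_path (verts r ((p, c) # xs)) (edges ((p, c) # xs)) q"
    "hd q \<noteq> c" "last q \<noteq> c"
  shows "is_path (verts r xs) (edges xs) q"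
proof -
  let ?E = "edges ((p, c) # xs)"
  have "c \<notin> set q"
  proof
    assume "c \<in> set q"
    then obtain ys zs where q: "q = ys @ c # zs" by (auto simp: in_set_conv_decomp)
    with assms(3,4) have ne: "ys \<noteq> []" "zs \<noteq> []" by auto
    then obtain ys' a b zs' where "ys = ys' @ [a]" "zs = b # zs'"
      by (metis list.exhaust rev_exhaust)
    then have q': "q = ys' @ [a, c, b] @ zs'" using q by simp
    then have "{a, c} \<in> ?E" "{c, b} \<in> ?E" "a \<noteq> b"
      using assms(2) by (auto simp: is_path_def successively_append_iff)
    moreover have "a = p"
      using leaf_edge[OF assms(1), of a] \<open>{a, c} \<in> ?E\<close> by (simp only: insert_commute)
    moreover have "b = p" using leaf_edge[OF assms(1), of b] \<open>{c, b} \<in> ?E\<close> .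
    ultimately show False by simp
  qed
  then have *: "{x, y} \<in> ?E \<longleftrightarrow> {x, y} \<in> edges xs" if "x \<in> set q" "y \<in> set q" for x y
    using that by (auto simp: doubleton_eq_iff)
  have "successively (\<lambda>u v. {u, v} \<in> ?E) q \<longleftrightarrow> successively (\<lambda>u v. {u, v} \<in> edges xs) q"
    by (rule successively_cong) (simp_all only: *)
  then show ?thesis using assms(2) \<open>c \<notin> set q\<close> by (auto simp: is_path_def)
qed

text \<open>Uniqueness of paths in quantitative form: the length of a path depends on its ends only,
  so the infimum in \<open>graph_dist\<close> ranges over a single value.\<close>

lemma path_length_tree_dist:
  assumes "grown r xs" "is_path (verts r xs) (edges xs) q"
  shows "path_length len q = tree_dist len xs (hd q) (last q)"
  using assms
proof (induction r xs arbitrary: q rule: grown.induct)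
  case (1 r)
  then have "set q \<subseteq> {r}" "distinct q" "q \<noteq> []" by (auto simp: is_path_def)
  then have "q = [r]" by (cases q; cases "tl q") auto
  then show ?case by simp
next
  case (2 r p c xs)
  let ?V = "verts r ((p, c) # xs)" and ?E = "edges ((p, c) # xs)"
  have ne: "q \<noteq> []" and dist: "distinct q" using 2(3) by (auto simp: is_path_def)
  consider (hd) "hd q = c" | (last) "hd q \<noteq> c" "last q = c" | (old) "hd q \<noteq> c" "last q \<noteq> c"
    by blast
  then show ?case
  proof cases
    case hd
    with ne obtain q' where q': "q = c # q'" by (cases q) auto
    show ?thesis
    proof (cases q')
      case Nil
      then show ?thesis using q' by simp
    next
      case (Cons y zs)
      have "{c, y} \<in> ?E" and path: "is_path ?V ?E (y # zs)"
        using 2(3) unfolding q' Cons is_path_Cons by auto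
      then have y: "y = p" using leaf_edge 2(2) by metis
      have "c \<notin> set (y # zs)" using dist q' Cons by auto
      moreover have "last (y # zs) \<in> set (y # zs)" by (rule last_in_set) simp
      ultimately have l: "last (y # zs) \<noteq> c" "y \<noteq> c" by auto
      then have "is_path (verts r xs) (edges xs) (y # zs)"
        using path_avoids_leaf[OF 2(2) path] by simp
      then have "path_length len (y # zs) = tree_dist len xs y (last (y # zs))"
        using "2.IH"[of "y # zs"] 2(2) by simp
      then show ?thesis using l y unfolding q' Cons by (simp add: insert_commute)
    qed
  next
    case last
    with ne obtain q' where q': "q = q' @ [c]" by (metis append_butlast_last_id)
    have ne': "q' \<noteq> []" using q' last by auto
    then have "{last q', c} \<in> ?E" and path: "is_path ?V ?E q'"
      using \<open>is_path ?V ?E q\<close> unfolding q' by (auto simp: is_path_def successively_append_iff)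
    then have y: "last q' = p"
      using leaf_edge \<open>grown r ((p, c) # xs)\<close> by (metis insert_commute)
    have "last q' \<noteq> c" using dist q' ne' last_in_set[OF ne'] by auto
    then have "is_path (verts r xs) (edges xs) q'"
      using path_avoids_leaf[OF \<open>grown r ((p, c) # xs)\<close> path] last q' ne' by simp
    then have "path_length len q' = tree_dist len xs (hd q') p"
      using \<open>grown r ((p, c) # xs)\<close> "2.IH" y by auto
    then show ?thesis using last ne' y unfolding q' by (simp add: path_length_snoc)
  next
    case old
    then have "is_path (verts r xs) (edges xs) q"
      using path_avoids_leaf[OF 2(2,3)] by simp
    then show ?thesis using "2.IH" 2(2) old by auto
  qed
qed

lemma graph_dist_grown:
  assumes "grown r xs" "u \<in> verts r xs" "v \<in> verts r xs"
  shows "graph_dist (verts r xs) (edges xs) len u v = tree_dist len xs u v"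
proof -
  have "path_length len ` paths_between (verts r xs) (edges xs) u v = {tree_dist len xs u v}"
    using grown_path_ex[OF assms] path_length_tree_dist[OF assms(1)]
    by (auto simp: paths_between_def)
  then show ?thesis by (simp add: graph_dist_def)
qed

text \<open>In a tree the same path realises the distance for all weights, so distances are linear
  in the weights. This turns the comparison of two distances into one bound on charges.\<close>

lemma tree_dist_linear:
  "tree_dist (\<lambda>e. len e / a - len' e) xs u v = tree_dist len xs u v / a - tree_dist len' xs u v"
  by (induction xs arbitrary: u v) (auto simp: add_divide_distrib)

lemma tree_dist_sym: "tree_dist len xs u v = tree_dist len xs v u"
  by (induction xs arbitrary: u v) auto

text \<open>The charge of an edge is what it adds to the left-hand side of
  \<open>dist len u v / \<alpha> - dist (zero_on C len) u v \<le> \<beta>\<close>.\<close>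

definition charge :: "real \<Rightarrow> ('v set \<Rightarrow> real) \<Rightarrow> 'v set \<Rightarrow> bool \<Rightarrow> real" where
  "charge \<alpha> len e b = len e / \<alpha> - (if b then 0 else len e)"

lemma is_contraction_grown:
  assumes "grown r xs"
  shows "is_contraction (\<lambda>x. x / \<alpha> - \<beta>) (verts r xs) (edges xs) len C \<longleftrightarrow> C \<subseteq> edges xs \<and>
    (\<forall>u\<in>verts r xs. \<forall>v\<in>verts r xs. tree_dist (\<lambda>e. charge \<alpha> len e (e \<in> C)) xs u v \<le> \<beta>)"
proof -
  have "(\<lambda>e. charge \<alpha> len e (e \<in> C)) = (\<lambda>e. len e / \<alpha> - zero_on C len e)"
    by (auto simp: charge_def zero_on_def)
  then have "tree_dist (\<lambda>e. charge \<alpha> len e (e \<in> C)) xs u v \<le> \<beta> \<longleftrightarrow>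
      tree_dist len xs u v / \<alpha> - \<beta> \<le> tree_dist (zero_on C len) xs u v" for u v
    by (auto simp: tree_dist_linear)
  then show ?thesis using graph_dist_grown[OF assms] by (auto simp: is_contraction_def)
qed

section \<open>The value of a contraction of a tree\<close>

text \<open>The vertex of its component that was grown first.\<close>

fun top_of :: "'v set set \<Rightarrow> ('v \<times> 'v) list \<Rightarrow> 'v \<Rightarrow> 'v" where
  "top_of C [] = (\<lambda>v. v)"
| "top_of C ((p, c) # xs) = (top_of C xs)(c := if {p, c} \<in> C then top_of C xs p else c)"

text \<open>A rank that strictly increases from parent to child. It serves to exclude two
  uncontracted edges that run between the same two components in opposite directions.\<close>

fun birth :: "('v \<times> 'v) list \<Rightarrow> 'v \<Rightarrow> nat" where
  "birth [] v = 0"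
| "birth ((p, c) # xs) v = (if v = c then Suc (length xs) else birth xs v)"

lemma birth_le: "birth xs v \<le> length xs"
  by (induction xs v rule: birth.induct) auto

lemma top_of_in_verts:
  assumes "grown r xs" "v \<in> verts r xs"
  shows "top_of C xs v \<in> verts r xs"
  using assms by (induction r xs arbitrary: v rule: grown.induct) auto

lemma birth_top_of:
  assumes "grown r xs" "v \<in> verts r xs"
  shows "birth xs (top_of C xs v) \<le> birth xs v"
  using assms
proof (induction r xs arbitrary: v rule: grown.induct)
  case (2 r p c xs)
  have "top_of C xs p \<noteq> c" using 2 top_of_in_verts[of r xs p C] by auto
  then show ?case
    using 2 top_of_in_verts[of r xs v C] by (auto intro: le_SucI birth_le)
qed simp

lemma birth_less:
  assumes "grown r xs" "(p, c) \<in> set xs"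
  shows "birth xs p < birth xs c"
  using assms
proof (induction r xs rule: grown.induct)
  case (2 r p' c' xs)
  have "p' \<noteq> c'" using 2 by auto
  have *: "p \<noteq> c' \<and> c \<noteq> c'" if "(p, c) \<in> set xs"
  proof -
    have "{p, c} \<in> edges xs" using that by (force simp: edges_def)
    then show ?thesis using grown_edge_subset[of r xs "{p, c}"] 2 by auto
  qed
  show ?case using 2 * \<open>p' \<noteq> c'\<close> birth_le[of xs p'] by auto
qed simp

lemma top_of_edge:
  assumes "grown r xs" "(p, c) \<in> set xs"
  shows "top_of C xs c = (if {p, c} \<in> C then top_of C xs p else c)"
  using assms
proof (induction r xs rule: grown.induct)
  case (2 r p' c' xs)
  have "p \<noteq> c' \<and> c \<noteq> c'" if "(p, c) \<in> set xs"
  proof -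
    have "{p, c} \<in> edges xs" using that by (force simp: edges_def)
    then show ?thesis using grown_edge_subset[of r xs "{p, c}"] 2 by auto
  qed
  then show ?case using 2 by auto
qed simp

text \<open>A child joined to its parent by a contracted edge inherits the top of the parent, so
  tops do not change along walks of contracted edges. Hence different tops certify different
  components.\<close>

lemma top_of_component:
  assumes "grown r xs" "C \<subseteq> edges xs" "y \<in> component C x"
  shows "top_of C xs y = top_of C xs x"
proof -
  have "(x, y) \<in> {(x, y). {x, y} \<in> C}\<^sup>*" using assms(3) by (simp add: component_def)
  then show ?thesis
  proof (induction rule: rtrancl_induct)
    case (step y z)
    then have "{y, z} \<in> C" by simp
    then obtain p c where "(p, c) \<in> set xs" "{p, c} = {y, z}"
      using assms(2) by (fastforce simp: edges_def)
    then have "top_of C xs y = top_of C xs z"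
      using top_of_edge[OF assms(1), of p c C] \<open>{y, z} \<in> C\<close>
      by (auto simp: doubleton_eq_iff insert_commute)
    then show ?case using step by simp
  qed simp
qed

lemma grown_parent_unique:
  assumes "grown r xs" "(p, c) \<in> set xs" "(p', c) \<in> set xs"
  shows "p = p'"
  using assms by (induction r xs rule: grown.induct) (auto simp: verts_def rev_image_eqI)

text \<open>In a tree contracting creates neither parallel edges nor loops beyond \<open>C\<close>
  itself: \<open>q\<close> is a bijection from the uncontracted edges to the edges of the quotient.
  The child of an uncontracted edge is the top of its component and therefore identifies the
  edge.\<close>

lemma contraction_value_grown:
  assumes "grown r xs" "C \<subseteq> edges xs"
  shows "contraction_value (edges xs) C = int (card C)"
proof -
  let ?co = "component C" and ?top = "top_of C xs"
  define q where "q e = ?co ` e" for e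
  have self: "x \<in> ?co x" for x by (simp add: component_def)
  have comp_top: "?top x = ?top y" if "?co x = ?co y" for x y
    using top_of_component[OF assms, of x y] self[of x] that by simp
  have cut: "?top c = c" "birth xs (?top p) < birth xs c"
    if "(p, c) \<in> set xs" "{p, c} \<notin> C" for p c
  proof -
    show "?top c = c" using top_of_edge[OF assms(1) that(1)] that by simp
    have "{p, c} \<in> edges xs" using that by (force simp: edges_def)
    then have "p \<in> verts r xs" using grown_edge_subset[OF assms(1)] by blast
    then show "birth xs (?top p) < birth xs c"
      using birth_top_of[OF assms(1), of p C] birth_less[OF assms(1) that(1)] by simp
  qed
  have inj: "inj_on q (edges xs - C)"
  proof (rule inj_onI)
    fix e e' assume e: "e \<in> edges xs - C" and e': "e' \<in> edges xs - C" and eq: "q e = q e'"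
    then obtain p c p' c' where *: "(p, c) \<in> set xs" "e = {p, c}" "(p', c') \<in> set xs" "e' = {p', c'}"
      by (fastforce simp: edges_def)
    have "{?co p, ?co c} = {?co p', ?co c'}" using eq * by (simp add: q_def)
    then consider "?co c = ?co c'" | "?co c = ?co p'" "?co p = ?co c'"
      by (auto simp: doubleton_eq_iff)
    then show "e = e'"
    proof cases
      case 1
      then have "c = c'" using comp_top[OF 1] cut * e e' by auto
      moreover have "p = p'"
        using grown_parent_unique[OF assms(1)] *(1,3) \<open>c = c'\<close> by blast
      ultimately show ?thesis using * by simp
    next
      \<comment> \<open>Here \<open>c'\<close> is the top of \<open>p\<close> and \<open>c\<close>
        the top of \<open>p'\<close>, so \<open>birth c' < birth c\<close> and
        \<open>birth c < birth c'\<close>.\<close>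
      case 2
      then have "?top p' = c" "?top p = c'"
        using comp_top[of c p'] comp_top[of p c'] cut(1)[of p c] cut(1)[of p' c'] * e e' by simp_all
      then show ?thesis using cut(2)[of p c] cut(2)[of p' c'] * e e' by simp
    qed
  qed
  have "quotient_edges (edges xs) C = q ` (edges xs - C)"
  proof (intro equalityI subsetI)
    fix X assume "X \<in> quotient_edges (edges xs) C"
    then obtain u v where uv: "X = {?co u, ?co v}" "{u, v} \<in> edges xs" "?co u \<noteq> ?co v"
      by (auto simp: quotient_edges_def)
    have "{u, v} \<notin> C"
    proof
      assume "{u, v} \<in> C"
      then have uv': "(u, v) \<in> {(x, y). {x, y} \<in> C}" "(v, u) \<in> {(x, y). {x, y} \<in> C}"
        by (auto simp: insert_commute)
      have "?co u = ?co v"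
        unfolding component_def using uv'
        by (auto intro: converse_rtrancl_into_rtrancl)
      then show False using uv by simp
    qed
    then have "{u, v} \<in> edges xs - C" "X = q {u, v}" using uv by (auto simp: q_def)
    then show "X \<in> q ` (edges xs - C)" by (rule rev_image_eqI)
  next
    fix X assume "X \<in> q ` (edges xs - C)"
    then obtain p c where *: "(p, c) \<in> set xs" "{p, c} \<notin> C" "X = {?co p, ?co c}"
      by (fastforce simp: edges_def q_def)
    then have "?top p \<noteq> ?top c" using cut[of p c] by auto
    then have "?co p \<noteq> ?co c" using comp_top by blast
    moreover have "{p, c} \<in> edges xs" using * by (force simp: edges_def)
    ultimately show "X \<in> quotient_edges (edges xs) C" using * by (auto simp: quotient_edges_def)
  qed
  then have "card (quotient_edges (edges xs) C) = card (edges xs - C)"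
    using inj by (simp add: card_image)
  moreover have "card (edges xs - C) = card (edges xs) - card C" "card C \<le> card (edges xs)"
    using assms(2) finite_subset[OF assms(2)] by (simp_all add: card_Diff_subset card_mono)
  ultimately show ?thesis by (simp add: contraction_value_def)
qed

section \<open>Absorbing the leaves of a tree\<close>

text \<open>\<open>D v\<close> is the largest charge of a path from \<open>v\<close> into the part of the tree that has
  been absorbed by \<open>v\<close>. A leaf that is absorbed must not close a path of charge more than \<open>\<beta>\<close>.\<close>

fun absorbable :: "real \<Rightarrow> ('v set \<Rightarrow> real) \<Rightarrow> ('v \<Rightarrow> real) \<Rightarrow> ('v \<times> 'v) list \<Rightarrow> bool" where
  "absorbable \<beta> w D [] \<longleftrightarrow> True"
| "absorbable \<beta> w D ((p, c) # xs) \<longleftrightarrow> D p + (D c + w {p, c}) \<le> \<beta> \<and>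
     absorbable \<beta> w (D(p := max (D p) (D c + w {p, c}))) xs"

lemma absorbable_cong:
  assumes "grown r xs" "\<And>v. v \<in> verts r xs \<Longrightarrow> D v = D' v" "\<And>e. e \<in> edges xs \<Longrightarrow> w e = w' e"
  shows "absorbable \<beta> w D xs \<longleftrightarrow> absorbable \<beta> w' D' xs"
  using assms
proof (induction r xs arbitrary: D D' rule: grown.induct)
  case (2 r p c xs)
  have "absorbable \<beta> w (D(p := max (D p) (D c + w {p, c}))) xs \<longleftrightarrow>
      absorbable \<beta> w' (D'(p := max (D' p) (D' c + w' {p, c}))) xs"
    using 2 by (intro "2.IH") auto
  then show ?case using 2 by simp
qed simp

text \<open>\<open>D u + tree_dist w xs u v + D v\<close> is the largest charge of a path from the
  part at \<open>u\<close> to the part at \<open>v\<close>. Absorbing \<open>c\<close> tests the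
  pair of \<open>p\<close> and \<open>c\<close>; the maximum stored at \<open>p\<close> splits each
  later condition on \<open>p\<close> into one for \<open>p\<close> and one for \<open>c\<close>.
  Pairs with \<open>u = v\<close> are left out because paths inside a part were tested while it was
  formed.\<close>

lemma absorbable_iff:
  assumes "grown r xs"
  shows "absorbable \<beta> w D xs \<longleftrightarrow>
    (\<forall>u\<in>verts r xs. \<forall>v\<in>verts r xs. u \<noteq> v \<longrightarrow> D u + tree_dist w xs u v + D v \<le> \<beta>)"
  using assms
proof (induction r xs arbitrary: D rule: grown.induct)
  case (2 r p c xs)
  let ?V = "verts r xs" and ?d = "tree_dist w xs" and ?w = "w {p, c}"
  let ?D = "D(p := max (D p) (D c + ?w))"
  have pc: "p \<in> ?V" "c \<notin> ?V" "p \<noteq> c" using 2 by auto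
  have "absorbable \<beta> w D ((p, c) # xs) \<longleftrightarrow> D p + (D c + ?w) \<le> \<beta> \<and>
      (\<forall>u\<in>?V. \<forall>v\<in>?V. u \<noteq> v \<longrightarrow> ?D u + ?d u v + ?D v \<le> \<beta>)"
    using 2 by simp
  also have "\<dots> \<longleftrightarrow> D p + (D c + ?w) \<le> \<beta> \<and>
      (\<forall>u\<in>?V. \<forall>v\<in>?V. u \<noteq> v \<longrightarrow> D u + ?d u v + D v \<le> \<beta>) \<and>
      (\<forall>v\<in>?V. v \<noteq> p \<longrightarrow> D c + (?w + ?d p v) + D v \<le> \<beta>)" (is "?A \<longleftrightarrow> ?B")
  proof
    assume A: ?A
    have "D u + ?d u v + D v \<le> ?D u + ?d u v + ?D v" for u v by auto
    moreover have "D c + (?w + ?d p v) + D v \<le> ?D p + ?d p v + ?D v" if "v \<noteq> p" for v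
      using that by auto
    moreover have "?D u + ?d u v + ?D v \<le> \<beta>" if "u \<in> ?V" "v \<in> ?V" "u \<noteq> v" for u v
      using A that by blast
    ultimately show ?B using A pc(1) by (blast intro: order_trans)
  next
    assume B: ?B
    have "?D u + ?d u v + ?D v \<le> \<beta>" if "u \<in> ?V" "v \<in> ?V" "u \<noteq> v" for u v
    proof -
      have "D u + ?d u v + D v \<le> \<beta>" using B that by blast
      moreover have "v \<noteq> p \<longrightarrow> D c + (?w + ?d p v) + D v \<le> \<beta>"
        "u \<noteq> p \<longrightarrow> D c + (?w + ?d p u) + D u \<le> \<beta>"
        using B that by blast+
      ultimately show ?thesis
        using tree_dist_sym[of w xs p u] \<open>u \<noteq> v\<close> by (cases "u = p"; cases "v = p") auto
    qed
    then show ?A using B by blast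
  qed
  also have "\<dots> \<longleftrightarrow> (\<forall>u\<in>verts r ((p, c) # xs). \<forall>v\<in>verts r ((p, c) # xs). u \<noteq> v \<longrightarrow>
      D u + tree_dist w ((p, c) # xs) u v + D v \<le> \<beta>)" (is "?B \<longleftrightarrow> ?C")
  proof
    assume B: ?B
    \<comment> \<open>The case \<open>v = p\<close> is missing from the last conjunct of
      \<open>?B\<close>; it is the test made when \<open>c\<close> is absorbed.\<close>
    have "D c + (?w + ?d p v) + D v \<le> \<beta>" if "v \<in> ?V" for v
      using B that by (cases "v = p") (auto simp: algebra_simps)
    then show ?C using B pc tree_dist_sym[of w xs _ p] by (auto simp: algebra_simps)
  next
    assume C: ?C
    have "D p + (D c + ?w) \<le> \<beta>" using C pc by (auto dest!: bspec[of _ _ p] simp: algebra_simps)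
    moreover have "D u + ?d u v + D v \<le> \<beta>" if "u \<in> ?V" "v \<in> ?V" "u \<noteq> v" for u v
    proof -
      have "u \<noteq> c" "v \<noteq> c" using that pc by auto
      then show ?thesis using bspec[OF bspec[OF C, of u], of v] that by simp
    qed
    moreover have "D c + (?w + ?d p v) + D v \<le> \<beta>" if "v \<in> ?V" for v
    proof -
      have "v \<noteq> c" using that pc by auto
      then show ?thesis using bspec[OF bspec[OF C, of c], of v] that by simp
    qed
    ultimately show ?B by blast
  qed
  finally show ?case .
qed simp

text \<open>Contractions also compare \<open>u\<close> with itself, which
  \<open>absorbable_iff\<close> leaves out; there the distance is 0 and the bound reads 0 \<le>
  \<beta>.\<close>

lemma is_contraction_absorbable:
  assumes "grown r xs" "0 \<le> \<beta>"
  shows "is_contraction (\<lambda>x. x / \<alpha> - \<beta>) (verts r xs) (edges xs) len C \<longleftrightarrow>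
    C \<subseteq> edges xs \<and> absorbable \<beta> (\<lambda>e. charge \<alpha> len e (e \<in> C)) (\<lambda>_. 0) xs"
proof -
  have "tree_dist w xs u v \<le> \<beta>" if "u = v" for w u v
    using that assms(2) by simp
  then show ?thesis
    unfolding is_contraction_grown[OF assms(1)] absorbable_iff[OF assms(1)] by force
qed

section \<open>Partial solutions\<close>

text \<open>A partial solution at a vertex is a set of contracted edges of the part absorbed by this
  vertex, together with the largest charge of a path from the vertex into this part.\<close>

definition merge :: "real \<Rightarrow> (bool \<Rightarrow> real) \<Rightarrow> 'e \<Rightarrow> ('e set \<times> real) set \<Rightarrow> ('e set \<times> real) set \<Rightarrow>
    ('e set \<times> real) set" where
  "merge \<beta> w e X Y = {(A \<union> B \<union> (if b then {e} else {}), max x (y + w b)) | A x B y b.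
     (A, x) \<in> X \<and> (B, y) \<in> Y \<and> x + (y + w b) \<le> \<beta>}"

lemma mergeI:
  "(A, x) \<in> X \<Longrightarrow> (B, y) \<in> Y \<Longrightarrow> x + (y + w b) \<le> \<beta> \<Longrightarrow>
    (A \<union> B \<union> (if b then {e} else {}), max x (y + w b)) \<in> merge \<beta> w e X Y"
  unfolding merge_def by blast

lemma mergeE:
  assumes "(C, z) \<in> merge \<beta> w e X Y"
  obtains A x B y b where "(A, x) \<in> X" "(B, y) \<in> Y" "x + (y + w b) \<le> \<beta>"
    "C = A \<union> B \<union> (if b then {e} else {})" "z = max x (y + w b)"
  using assms unfolding merge_def by blast

text \<open>\<open>S v\<close> holds the partial solutions at \<open>v\<close>, and
  \<open>B v\<close> is the block of edges absorbed by \<open>v\<close>. Keeping the blocks disjoint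
  from each other and from the remaining edges makes a set recoverable from its traces and makes
  cardinalities additive.\<close>

definition pending :: "real \<Rightarrow> 'v \<Rightarrow> ('v \<times> 'v) list \<Rightarrow> ('v \<Rightarrow> ('v set set \<times> real) set) \<Rightarrow>
    ('v \<Rightarrow> 'v set set) \<Rightarrow> bool" where
  "pending \<beta> r xs S B \<longleftrightarrow> (\<forall>v\<in>verts r xs. finite (B v) \<and> B v \<inter> edges xs = {} \<and>
     (\<forall>u\<in>verts r xs. u \<noteq> v \<longrightarrow> B u \<inter> B v = {}) \<and>
     (\<forall>(A, x)\<in>S v. A \<subseteq> B v \<and> 0 \<le> x \<and> x \<le> \<beta>))"

text \<open>The traces of \<open>C\<close> on the blocks must be stored partial solutions whose
  charges allow the remaining edges to be absorbed. Fixing the final set \<open>C\<close> gives a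
  property that stays the same while blocks grow.\<close>

definition completes :: "real \<Rightarrow> ('v set \<Rightarrow> bool \<Rightarrow> real) \<Rightarrow> 'v \<Rightarrow> ('v \<times> 'v) list \<Rightarrow>
    ('v \<Rightarrow> ('v set set \<times> real) set) \<Rightarrow> ('v \<Rightarrow> 'v set set) \<Rightarrow> 'v set set \<Rightarrow> bool" where
  "completes \<beta> w r xs S B C \<longleftrightarrow> C \<subseteq> edges xs \<union> (\<Union>v\<in>verts r xs. B v) \<and>
     (\<exists>D. (\<forall>v\<in>verts r xs. (C \<inter> B v, D v) \<in> S v) \<and> absorbable \<beta> (\<lambda>e. w e (e \<in> C)) D xs)"

lemma pendingD:
  assumes "pending \<beta> r xs S B" "v \<in> verts r xs"
  shows "finite (B v)" "B v \<inter> edges xs = {}"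
    "u \<in> verts r xs \<Longrightarrow> u \<noteq> v \<Longrightarrow> B u \<inter> B v = {}"
    "(A, x) \<in> S v \<Longrightarrow> A \<subseteq> B v" "(A, x) \<in> S v \<Longrightarrow> 0 \<le> x" "(A, x) \<in> S v \<Longrightarrow> x \<le> \<beta>"
proof -
  have "finite (B v) \<and> B v \<inter> edges xs = {} \<and>
     (\<forall>u\<in>verts r xs. u \<noteq> v \<longrightarrow> B u \<inter> B v = {}) \<and>
     (\<forall>(A, x)\<in>S v. A \<subseteq> B v \<and> 0 \<le> x \<and> x \<le> \<beta>)"
    using assms unfolding pending_def by blast
  then show "finite (B v)" "B v \<inter> edges xs = {}"
    "u \<in> verts r xs \<Longrightarrow> u \<noteq> v \<Longrightarrow> B u \<inter> B v = {}"
    "(A, x) \<in> S v \<Longrightarrow> A \<subseteq> B v" "(A, x) \<in> S v \<Longrightarrow> 0 \<le> x" "(A, x) \<in> S v \<Longrightarrow> x \<le> \<beta>"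
    by auto
qed

text \<open>The upper bound survives because \<open>0 \<le> x\<close> and
  \<open>x + (y + w b) \<le> \<beta>\<close> imply \<open>y + w b \<le> \<beta>\<close>.\<close>

lemma pending_step:
  assumes "grown r ((p, c) # xs)" "pending \<beta> r ((p, c) # xs) S B"
  shows "pending \<beta> r xs (S(p := merge \<beta> w {p, c} (S p) (S c)))
    (B(p := B p \<union> B c \<union> {{p, c}}))"
proof -
  let ?V = "verts r xs"
  have pc: "p \<in> ?V" "c \<notin> ?V" "grown r xs" using assms by auto
  have new: "{p, c} \<notin> edges xs" using grown_edge_subset[OF pc(3)] pc(2) by blast
  note pend = pendingD[OF assms(2), unfolded verts_simps edges_simps]
  have "A \<subseteq> B p \<union> B c \<union> {{p, c}} \<and> 0 \<le> x \<and> x \<le> \<beta>"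
    if "(A, x) \<in> merge \<beta> w {p, c} (S p) (S c)" for A x
    using that
  proof (rule mergeE)
    fix A' x' B' y b
    assume *: "(A', x') \<in> S p" "(B', y) \<in> S c" "x' + (y + w b) \<le> \<beta>"
      "A = A' \<union> B' \<union> (if b then {{p, c}} else {})" "x = max x' (y + w b)"
    then have "A' \<subseteq> B p" "0 \<le> x'" "x' \<le> \<beta>" "B' \<subseteq> B c"
      using pend(4-6)[OF _ *(1)] pend(4)[OF _ *(2)] pc(1) by simp_all
    then show ?thesis using * by auto
  qed
  note new_sol = this
  show ?thesis
    unfolding pending_def
  proof (intro ballI conjI impI; (clarify; fail)?)
    fix v assume v: "v \<in> ?V"
    let ?B = "B(p := B p \<union> B c \<union> {{p, c}})"
    show "finite (?B v)" using pend(1) v by (auto simp: pc)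
    show "?B v \<inter> edges xs = {}" using pend(2) v new by (auto simp: pc)
    show "?B u \<inter> ?B v = {}" if "u \<in> ?V" "u \<noteq> v" for u
    proof -
      have "B u \<inter> B v = {}" "B c \<inter> B u = {}" "B c \<inter> B v = {}" "{p, c} \<notin> B u" "{p, c} \<notin> B v"
        using pend(2)[of u] pend(2)[of v] pend(3)[of v u] pend(3)[of u c] pend(3)[of v c] that v pc(2)
        by auto
      then show ?thesis using that by auto
    qed
    show "case z of (A, x) \<Rightarrow> A \<subseteq> ?B v \<and> 0 \<le> x \<and> x \<le> \<beta>"
      if "z \<in> (S(p := merge \<beta> w {p, c} (S p) (S c))) v" for z
      using that new_sol[of "fst z" "snd z"] pend(4-6)[of v "fst z" "snd z"] v
      by (cases z; cases "v = p") auto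
  qed
qed

text \<open>The new block of \<open>p\<close> is the disjoint union of the two old blocks and the
  edge \<open>{p, c}\<close>, so a trace on it determines both old traces and the choice made for
  that edge.\<close>

lemma completes_step:
  assumes "grown r ((p, c) # xs)" "pending \<beta> r ((p, c) # xs) S B"
  shows "completes \<beta> w r xs (S(p := merge \<beta> (w {p, c}) {p, c} (S p) (S c)))
      (B(p := B p \<union> B c \<union> {{p, c}})) C \<longleftrightarrow>
    completes \<beta> w r ((p, c) # xs) S B C"
    (is "completes _ _ _ _ ?S ?B _ \<longleftrightarrow> _")
proof -
  let ?V = "verts r xs" and ?e = "{p, c}"
  let ?w = "\<lambda>e. w e (e \<in> C)"
  have pc: "p \<in> ?V" "c \<notin> ?V" "grown r xs" "p \<noteq> c" using assms by auto
  note pend = pendingD[OF assms(2), unfolded verts_simps edges_simps]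
  have dis: "B p \<inter> B c = {}" "?e \<notin> B p" "?e \<notin> B c"
    using pend(2)[of p] pend(2)[of c] pend(3)[of c p] pc by auto
  have "(\<Union>v\<in>?V. ?B v) = insert ?e (\<Union>v\<in>insert c ?V. B v)"
    using pc by auto
  then have cover: "C \<subseteq> edges xs \<union> (\<Union>v\<in>?V. ?B v) \<longleftrightarrow>
      C \<subseteq> edges ((p, c) # xs) \<union> (\<Union>v\<in>verts r ((p, c) # xs). B v)" by simp
  show ?thesis
  proof
    assume "completes \<beta> w r xs ?S ?B C"
    then obtain D where D: "\<forall>v\<in>?V. (C \<inter> ?B v, D v) \<in> ?S v" "absorbable \<beta> ?w D xs"
      by (auto simp: completes_def)
    then have "(C \<inter> ?B p, D p) \<in> merge \<beta> (w ?e) ?e (S p) (S c)" using pc(1) by force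
    then obtain A x A' y b where m: "(A, x) \<in> S p" "(A', y) \<in> S c" "x + (y + w ?e b) \<le> \<beta>"
        "C \<inter> ?B p = A \<union> A' \<union> (if b then {?e} else {})" "D p = max x (y + w ?e b)"
      by (rule mergeE)
    have AA': "A \<subseteq> B p" "A' \<subseteq> B c" using pend(4)[OF _ m(1)] pend(4)[OF _ m(2)] pc(1) by simp_all
    have e: "?e \<notin> A" "?e \<notin> A'" using AA' dis by auto
    have "?e \<in> C \<inter> ?B p \<longleftrightarrow> ?e \<in> C" by simp
    then have b: "b \<longleftrightarrow> ?e \<in> C" unfolding m(4) using e by (auto split: if_splits)
    have "C \<inter> B p = (C \<inter> ?B p) \<inter> B p" "C \<inter> B c = (C \<inter> ?B p) \<inter> B c" by auto
    then have split: "C \<inter> B p = A" "C \<inter> B c = A'"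
      unfolding m(4) using AA' dis by (auto split: if_splits)
    \<comment> \<open>The charges before merging are restored: the value at \<open>p\<close> was the
      maximum, and the value at \<open>c\<close> was unconstrained since \<open>c\<close> is no
      longer a vertex.\<close>
    define D' where "D' = D(p := x, c := y)"
    have "(C \<inter> B v, D' v) \<in> S v" if "v \<in> verts r ((p, c) # xs)" for v
    proof -
      have "v = c \<or> v = p \<or> v \<in> ?V \<and> v \<noteq> p \<and> v \<noteq> c" using that by auto
      then show ?thesis using m(1,2) split D(1) pc(4) by (elim disjE) (auto simp: D'_def)
    qed
    moreover have "absorbable \<beta> ?w D' ((p, c) # xs)"
    proof -
      have "absorbable \<beta> ?w D xs \<longleftrightarrow>
          absorbable \<beta> ?w (D'(p := max (D' p) (D' c + ?w ?e))) xs"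
        using m(5) b pc by (intro absorbable_cong[OF pc(3)]) (auto simp: D'_def)
      then show ?thesis using D(2) m(3) b pc(4) by (simp add: D'_def)
    qed
    ultimately show "completes \<beta> w r ((p, c) # xs) S B C"
      using \<open>completes \<beta> w r xs ?S ?B C\<close> cover unfolding completes_def by blast
  next
    assume "completes \<beta> w r ((p, c) # xs) S B C"
    then obtain D where D: "\<forall>v\<in>insert c ?V. (C \<inter> B v, D v) \<in> S v"
        "D p + (D c + ?w ?e) \<le> \<beta>" "absorbable \<beta> ?w (D(p := max (D p) (D c + ?w ?e))) xs"
      by (auto simp: completes_def)
    have "(C \<inter> B p, D p) \<in> S p" "(C \<inter> B c, D c) \<in> S c" using D(1) pc by auto
    note mergeI[where w = "w ?e" and e = ?e, OF this D(2)]
    moreover have "C \<inter> B p \<union> C \<inter> B c \<union> (if ?e \<in> C then {?e} else {}) = C \<inter> ?B p" by auto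
    ultimately have "\<forall>v\<in>?V. (C \<inter> ?B v, (D(p := max (D p) (D c + ?w ?e))) v) \<in> ?S v"
      using D(1) by auto
    then show "completes \<beta> w r xs ?S ?B C"
      using \<open>completes \<beta> w r ((p, c) # xs) S B C\<close> cover D(3) unfolding completes_def by blast
  qed
qed

lemma completes_start:
  assumes "grown r xs" "0 \<le> \<beta>"
  shows "completes \<beta> (charge \<alpha> len) r xs (\<lambda>_. {({}, 0)}) (\<lambda>_. {}) C \<longleftrightarrow>
    is_contraction (\<lambda>x. x / \<alpha> - \<beta>) (verts r xs) (edges xs) len C"
proof -
  let ?w = "\<lambda>e. charge \<alpha> len e (e \<in> C)"
  have "(\<exists>D. (\<forall>v\<in>verts r xs. D v = 0) \<and> absorbable \<beta> ?w D xs) \<longleftrightarrow> absorbable \<beta> ?w (\<lambda>_. 0) xs"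
    using absorbable_cong[OF assms(1), of _ "\<lambda>_. 0" ?w ?w] by (metis (no_types, lifting))
  then show ?thesis
    unfolding is_contraction_absorbable[OF assms] completes_def by auto
qed

lemma completes_finish:
  "pending \<beta> r [] S B \<Longrightarrow> completes \<beta> w r [] S B C \<longleftrightarrow> (\<exists>x. (C, x) \<in> S r)"
  by (auto simp: completes_def pending_def Int_absorb2 exI[of _ "\<lambda>_. _"])

section \<open>Tabulating partial solutions by their number of edges\<close>

text \<open>Stored charges never exceed \<beta>, so an entry above \<beta> says that no partial
  solution of this cardinality exists; \<open>g k\<close> is then arbitrary. An entry up to \<beta>
  is an attained minimum.\<close>

definition tabulates :: "real \<Rightarrow> nat \<Rightarrow> ('e set \<times> real) set \<Rightarrow> (nat \<Rightarrow> real) \<Rightarrow> (nat \<Rightarrow> 'e set) \<Rightarrow> bool"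
  where "tabulates \<beta> n X f g \<longleftrightarrow> (\<forall>k<n. 0 \<le> f k \<and> (\<forall>(A, x)\<in>X. card A = k \<longrightarrow> f k \<le> x) \<and>
    (f k \<le> \<beta> \<longrightarrow> card (g k) = k \<and> (g k, f k) \<in> X))"

text \<open>The two entries are bounded separately because \<open>w b\<close> may be negative: the
  sum alone could be at most \<beta> although an entry is only the marker \<beta> + 1.\<close>

definition candidate :: "real \<Rightarrow> (bool \<Rightarrow> real) \<Rightarrow> (nat \<Rightarrow> real) \<Rightarrow> (nat \<Rightarrow> real) \<Rightarrow> nat \<Rightarrow>
    nat \<Rightarrow> nat \<Rightarrow> bool \<Rightarrow> bool" where
  "candidate \<beta> w f f' k i j b \<longleftrightarrow> i + j + of_bool b = k \<and> f i \<le> \<beta> \<and> f' j \<le> \<beta> \<and>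
     f i + (f' j + w b) \<le> \<beta>"

text \<open>The interface between the optimisation argument and the program: it mentions table
  entries but no sets of partial solutions.\<close>

definition merged_entry :: "real \<Rightarrow> (bool \<Rightarrow> real) \<Rightarrow> 'e \<Rightarrow> (nat \<Rightarrow> real) \<Rightarrow> (nat \<Rightarrow> 'e set) \<Rightarrow>
    (nat \<Rightarrow> real) \<Rightarrow> (nat \<Rightarrow> 'e set) \<Rightarrow> nat \<Rightarrow> real \<Rightarrow> 'e set \<Rightarrow> bool" where
  "merged_entry \<beta> w e f g f' g' k z C \<longleftrightarrow> 0 \<le> z \<and>
     (\<forall>i j b. candidate \<beta> w f f' k i j b \<longrightarrow> z \<le> max (f i) (f' j + w b)) \<and>
     (z \<le> \<beta> \<longrightarrow> (\<exists>i j b. candidate \<beta> w f f' k i j b \<and> z = max (f i) (f' j + w b) \<and>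
       C = g i \<union> g' j \<union> (if b then {e} else {})))"

text \<open>The exchange argument. Replacing two merged partial solutions by the tabulated ones of
  the same cardinalities does not increase \<open>x\<close> and \<open>y\<close>, so the test still
  succeeds and the new charge does not grow; disjointness of the blocks keeps the total
  cardinality.\<close>

lemma tabulates_merge:
  assumes X: "tabulates \<beta> n X f g" "\<forall>(A, x)\<in>X. A \<subseteq> P \<and> 0 \<le> x \<and> x \<le> \<beta>"
    and Y: "tabulates \<beta> n Y f' g'" "\<forall>(A, x)\<in>Y. A \<subseteq> Q \<and> 0 \<le> x \<and> x \<le> \<beta>"
    and PQ: "finite P" "finite Q" "P \<inter> Q = {}" "e \<notin> P" "e \<notin> Q"
    and new: "\<And>k. k < n \<Longrightarrow> merged_entry \<beta> w e f g f' g' k (h k) (G k)"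
  shows "tabulates \<beta> n (merge \<beta> w e X Y) h G"
proof -
  have card: "card (A \<union> B \<union> (if b then {e} else {})) = card A + card B + of_bool b"
    if "A \<subseteq> P" "B \<subseteq> Q" for A B b
  proof -
    have fin: "finite A" "finite B" "A \<inter> B = {}" "e \<notin> A \<union> B"
      using that PQ finite_subset by (blast+)
    then show ?thesis by (cases b) (auto simp: card_Un_disjoint)
  qed
  show ?thesis
    unfolding tabulates_def
  proof (intro allI impI conjI)
    fix k assume k: "k < n"
    note entry = new[OF k, unfolded merged_entry_def]
    show "0 \<le> h k" using entry by blast
    have "h k \<le> z" if "(C, z) \<in> merge \<beta> w e X Y" "card C = k" for C z
      using that(1)
    proof (rule mergeE)
      fix A x B y b
      assume *: "(A, x) \<in> X" "(B, y) \<in> Y" "x + (y + w b) \<le> \<beta>"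
        "C = A \<union> B \<union> (if b then {e} else {})" "z = max x (y + w b)"
      have AB: "A \<subseteq> P" "B \<subseteq> Q" "x \<le> \<beta>" "y \<le> \<beta>" using * X(2) Y(2) by auto
      then have kk: "card A + card B + of_bool b = k" using card *(4) that(2) by simp
      then have "card A < n" "card B < n" using k by auto
      then have le: "f (card A) \<le> x" "f' (card B) \<le> y"
        using X(1) Y(1) * by (auto simp: tabulates_def)
      then have "candidate \<beta> w f f' k (card A) (card B) b"
        using kk AB *(3) by (auto simp: candidate_def)
      then have "h k \<le> max (f (card A)) (f' (card B) + w b)" using entry by blast
      then show "h k \<le> z" using le *(5) by auto
    qed
    then show "\<forall>(C, z)\<in>merge \<beta> w e X Y. card C = k \<longrightarrow> h k \<le> z" by auto
    assume "h k \<le> \<beta>"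
    then obtain i j b where *: "candidate \<beta> w f f' k i j b" "h k = max (f i) (f' j + w b)"
        "G k = g i \<union> g' j \<union> (if b then {e} else {})"
      using entry by blast
    then have ij: "i + j + of_bool b = k" "f i \<le> \<beta>" "f' j \<le> \<beta>" "f i + (f' j + w b) \<le> \<beta>"
      by (auto simp: candidate_def)
    then have "i < n" "j < n" using k by auto
    then have sol: "card (g i) = i" "(g i, f i) \<in> X" "card (g' j) = j" "(g' j, f' j) \<in> Y"
      using X(1) Y(1) ij by (auto simp: tabulates_def)
    then have "g i \<subseteq> P" "g' j \<subseteq> Q" using X(2) Y(2) by auto
    then show "card (G k) = k" using card *(3) sol ij by simp
    show "(G k, h k) \<in> merge \<beta> w e X Y" unfolding *(2,3) by (rule mergeI) (use sol ij in auto)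
  qed
qed

lemma tabulates_optimal:
  assumes "tabulates \<beta> n X f g" "k < n" "f k \<le> \<beta>" "\<And>k'. k' < n \<Longrightarrow> f k' \<le> \<beta> \<Longrightarrow> k' \<le> k"
    and "\<forall>(A, x)\<in>X. x \<le> \<beta> \<and> card A < n"
  shows "\<exists>x. (g k, x) \<in> X" "(A, x) \<in> X \<Longrightarrow> card A \<le> card (g k)"
proof -
  show "\<exists>x. (g k, x) \<in> X" using assms(1-3) by (auto simp: tabulates_def)
  assume A: "(A, x) \<in> X"
  then have "card A < n" "x \<le> \<beta>" using assms(5) by auto
  moreover from this have "f (card A) \<le> x" using assms(1) A by (auto simp: tabulates_def)
  ultimately have "card A \<le> k" using assms(4) by simp
  moreover have "card (g k) = k" using assms(1-3) by (auto simp: tabulates_def)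
  ultimately show "card A \<le> card (g k)" by simp
qed

section \<open>Programs whose loops make a bounded number of iterations\<close>

text \<open>If every execution of every loop of \<open>P\<close> makes at most \<open>N\<close> iterations, then \<open>P\<close> halts within
  \<open>steps N P\<close> steps, which is a polynomial in \<open>N\<close> whose degree is the loop depth.\<close>

primrec steps :: "nat \<Rightarrow> com \<Rightarrow> nat" where
  "steps N Skip = 1"
| "steps N (NWrite a i x) = ncost i + ncost x + 1"
| "steps N (RWrite a i x) = ncost i + rcost x + 1"
| "steps N (Seq P Q) = steps N P + steps N Q"
| "steps N (Cond b P Q) = bcost b + 1 + (steps N P + steps N Q)"
| "steps N (Loop b P) = N * (bcost b + 1 + steps N P) + (bcost b + 1)"

primrec loop_depth :: "com \<Rightarrow> nat" where
  "loop_depth Skip = 0"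
| "loop_depth (NWrite a i x) = 0"
| "loop_depth (RWrite a i x) = 0"
| "loop_depth (Seq P Q) = max (loop_depth P) (loop_depth Q)"
| "loop_depth (Cond b P Q) = max (loop_depth P) (loop_depth Q)"
| "loop_depth (Loop b P) = Suc (loop_depth P)"

text \<open>With base \<open>N + 1\<close> every power is at least 1, so constants and lower powers
  can be raised to the degree of the deepest loop.\<close>

lemma steps_polynomial: "\<exists>K. \<forall>N. steps N P \<le> K * (N + 1) ^ loop_depth P"
proof -
  have mono: "K * (N + 1) ^ d \<le> K * (N + 1) ^ d'" if "d \<le> d'" for K N d d' :: nat
    using that by (simp add: power_increasing)
  have const: "k \<le> k * (N + 1) ^ d" for k N d :: nat by simp
  have both: "\<exists>K. \<forall>N. k + (f N + g N) \<le> K * (N + 1) ^ max d d'"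
    if "\<forall>N. f N \<le> K * (N + 1) ^ d" "\<forall>N. g N \<le> K' * (N + 1) ^ d'" for k K K' d d' and f g :: "nat \<Rightarrow> nat"
  proof (intro exI allI)
    fix N
    show "k + (f N + g N) \<le> (k + (K + K')) * (N + 1) ^ max d d'"
      using const[of k N "max d d'"] that[rule_format, of N]
        mono[of d "max d d'" K N] mono[of d' "max d d'" K' N]
      unfolding add_mult_distrib by linarith
  qed
  show ?thesis
  proof (induction P)
    case (Seq P Q)
    then show ?case using both[where k = 0] by auto
  next
    case (Cond b P Q)
    then show ?case using both[where k = "bcost b + 1"] by (auto simp: add.assoc)
  next
    case (Loop b P)
    then obtain K where K: "\<forall>N. steps N P \<le> K * (N + 1) ^ loop_depth P" by auto
    let ?k = "bcost b + 1" and ?d = "loop_depth P"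
    have "steps N (Loop b P) \<le> (2 * ?k + K) * (N + 1) ^ loop_depth (Loop b P)" for N
    proof -
      have "steps N (Loop b P) \<le> (N + 1) * (2 * ?k + steps N P)" by (simp add: algebra_simps)
      also have "\<dots> \<le> (N + 1) * (2 * ?k * (N + 1) ^ ?d + K * (N + 1) ^ ?d)"
        using K const[of "2 * ?k" N ?d] by (intro mult_left_mono add_mono) auto
      finally show ?thesis by (simp add: algebra_simps)
    qed
    then show ?case by blast
  qed auto
qed

lemma steps_bigo: "(\<lambda>n. real (steps n P)) \<in> O(\<lambda>n. real n ^ loop_depth P)"
proof -
  let ?d = "loop_depth P"
  obtain K where K: "\<And>N. steps N P \<le> K * (N + 1) ^ ?d" using steps_polynomial by blast
  \<comment> \<open>The factor \<open>2 ^ ?d\<close> comes from \<open>n + 1 \<le> 2 * n\<close>,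
    valid from \<open>n = 1\<close> on.\<close>
  have "norm (real (steps n P)) \<le> real (K * 2 ^ ?d) * norm (real n ^ ?d)" if "n \<ge> 1" for n
  proof -
    have "steps n P \<le> K * (2 * n) ^ ?d"
      using that by (intro le_trans[OF K[of n]] mult_le_mono2 power_mono) auto
    then have "real (steps n P) \<le> real (K * (2 * n) ^ ?d)" by (rule of_nat_mono)
    then show ?thesis by (simp add: power_mult_distrib mult.assoc)
  qed
  then show ?thesis by (intro bigoI[where c = "real (K * 2 ^ ?d)"] eventually_sequentiallyI[of 1])
qed

text \<open>Total correctness with the syntactic time bound built in, so that correctness proofs
  never have to mention time.\<close>

definition halts :: "nat \<Rightarrow> com \<Rightarrow> state \<Rightarrow> (state \<Rightarrow> bool) \<Rightarrow> bool" where
  "halts N P s Q \<longleftrightarrow> (\<exists>t s'. runs P s t s' \<and> t \<le> steps N P \<and> Q s')"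

lemma halts_mono:
  assumes "halts N P s Q" "\<And>s'. Q s' \<Longrightarrow> Q' s'"
  shows "halts N P s Q'"
  using assms unfolding halts_def by blast

lemma halts_Skip: "Q s \<Longrightarrow> halts N Skip s Q"
  unfolding halts_def by (intro exI[of _ 1] exI[of _ s]) (auto intro: runs.Skip[simplified])

lemma halts_NWrite: "Q (nwrite a (nval i s) (nval x s) s) \<Longrightarrow> halts N (NWrite a i x) s Q"
  unfolding halts_def using runs.NWrite[of a i x s] by (auto intro: exI)

lemma halts_RWrite: "Q (rwrite a (nval i s) (rval x s) s) \<Longrightarrow> halts N (RWrite a i x) s Q"
  unfolding halts_def using runs.RWrite[of a i x s] by (auto intro: exI)

text \<open>Variants that evaluate the expressions first, which keeps the states of a long sequence small.\<close>

lemma halts_NWriteI: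
  "nval i s = j \<Longrightarrow> nval x s = k \<Longrightarrow> Q (nwrite a j k s) \<Longrightarrow> halts N (NWrite a i x) s Q"
  by (simp add: halts_NWrite)

lemma halts_RWriteI:
  "nval i s = j \<Longrightarrow> rval x s = y \<Longrightarrow> Q (rwrite a j y s) \<Longrightarrow> halts N (RWrite a i x) s Q"
  by (simp add: halts_RWrite)

lemma halts_Seq:
  assumes "halts N P s (\<lambda>s'. halts N R s' Q)"
  shows "halts N (Seq P R) s Q"
proof -
  obtain t s' t' s'' where "runs P s t s'" "t \<le> steps N P" "runs R s' t' s''" "t' \<le> steps N R" "Q s''"
    using assms unfolding halts_def by blast
  then show ?thesis unfolding halts_def
    by (intro exI[of _ "t + t'"] exI[of _ s'']) (auto intro: runs.Seq)
qed

lemma halts_Cond: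
  assumes "bval b s \<Longrightarrow> halts N P s Q" "\<not> bval b s \<Longrightarrow> halts N R s Q"
  shows "halts N (Cond b P R) s Q"
proof (cases "bval b s")
  case True
  then obtain t s' where "runs P s t s'" "t \<le> steps N P" "Q s'" using assms unfolding halts_def by blast
  then show ?thesis using True unfolding halts_def
    by (intro exI[of _ "bcost b + 1 + t"] exI[of _ s']) (auto intro: runs.CondTrue[simplified])
next
  case False
  then obtain t s' where "runs R s t s'" "t \<le> steps N R" "Q s'" using assms unfolding halts_def by blast
  then show ?thesis using False unfolding halts_def
    by (intro exI[of _ "bcost b + 1 + t"] exI[of _ s']) (auto intro: runs.CondFalse[simplified])
qed

section \<open>Frame conditions from syntactic write sets\<close>

primrec nat_writes :: "com \<Rightarrow> string set" where
  "nat_writes Skip = {}"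
| "nat_writes (NWrite a i x) = {a}"
| "nat_writes (RWrite a i x) = {}"
| "nat_writes (Seq P Q) = nat_writes P \<union> nat_writes Q"
| "nat_writes (Cond b P Q) = nat_writes P \<union> nat_writes Q"
| "nat_writes (Loop b P) = nat_writes P"

primrec real_writes :: "com \<Rightarrow> string set" where
  "real_writes Skip = {}"
| "real_writes (NWrite a i x) = {}"
| "real_writes (RWrite a i x) = {a}"
| "real_writes (Seq P Q) = real_writes P \<union> real_writes Q"
| "real_writes (Cond b P Q) = real_writes P \<union> real_writes Q"
| "real_writes (Loop b P) = real_writes P"

definition agree :: "com \<Rightarrow> state \<Rightarrow> state \<Rightarrow> bool" where
  "agree P s s' \<longleftrightarrow> (\<forall>a. a \<notin> nat_writes P \<longrightarrow> nats s' a = nats s a) \<and>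
     (\<forall>a. a \<notin> real_writes P \<longrightarrow> reals s' a = reals s a)"

lemma agreeD:
  "agree P s s' \<Longrightarrow> a \<notin> nat_writes P \<Longrightarrow> nats s' a = nats s a"
  "agree P s s' \<Longrightarrow> a \<notin> real_writes P \<Longrightarrow> reals s' a = reals s a"
  by (auto simp: agree_def)

lemma agree_trans: "agree P s s' \<Longrightarrow> agree P s' s'' \<Longrightarrow> agree P s s''"
  by (simp add: agree_def)

lemma write_simps [simp]:
  "nats (nwrite a i k s) b j = (if b = a \<and> j = i then k else nats s b j)"
  "reals (nwrite a i k s) = reals s"
  "reals (rwrite a i x s) b j = (if b = a \<and> j = i then x else reals s b j)"
  "nats (rwrite a i x s) = nats s"
  by (auto simp: nwrite_def rwrite_def)

lemma nats_nwrite_other: "b \<noteq> a \<Longrightarrow> nats (nwrite a i k s) b = nats s b"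
  by (simp add: nwrite_def)

lemma reals_rwrite_other: "b \<noteq> a \<Longrightarrow> reals (rwrite a i x s) b = reals s b"
  by (simp add: rwrite_def)

lemma runs_agree: "runs P s t s' \<Longrightarrow> agree P s s'"
  by (induction rule: runs.induct) (auto simp: agree_def nats_nwrite_other reals_rwrite_other)

lemma halts_agree:
  assumes "halts N P s Q"
  shows "halts N P s (\<lambda>s'. agree P s s' \<and> Q s')"
  using assms runs_agree unfolding halts_def by blast

lemma halts_use:
  assumes "halts N P s Q" "\<And>s'. agree P s s' \<Longrightarrow> Q s' \<Longrightarrow> Q' s'"
  shows "halts N P s Q'"
  using halts_agree[OF assms(1)] by (rule halts_mono) (use assms(2) in blast)

section \<open>Counting loops\<close>

abbreviation Var :: "string \<Rightarrow> nexp" where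
  "Var x \<equiv> NRead x (NConst 0)"

definition For :: "string \<Rightarrow> nexp \<Rightarrow> com \<Rightarrow> com" where
  "For x b P = Seq (NWrite x (NConst 0) (NConst 0))
     (Loop (NLess (Var x) b) (Seq P (NWrite x (NConst 0) (NAdd (Var x) (NConst 1)))))"

lemma For_simps [simp]:
  "loop_depth (For x b P) = Suc (loop_depth P)"
  "nat_writes (For x b P) = insert x (nat_writes P)"
  "real_writes (For x b P) = real_writes P"
  by (auto simp: For_def)

text \<open>The guard is evaluated anew in every round, so its bound must be \<open>M\<close> in all
  states that agree with the initial one outside the written arrays. The invariant is required after
  the increment, because the counter is written by the loop and not by the body.\<close>

lemma halts_For:
  assumes N: "M \<le> N" and x: "x \<notin> nat_writes P"
    and bound: "\<And>s'. agree (For x b P) s s' \<Longrightarrow> nval b s' = M"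
    and init: "I 0 (nwrite x 0 0 s)"
    and step: "\<And>i s'. i < M \<Longrightarrow> I i s' \<Longrightarrow> nats s' x 0 = i \<Longrightarrow> agree (For x b P) s s' \<Longrightarrow>
      halts N P s' (\<lambda>s''. I (Suc i) (nwrite x 0 (Suc i) s''))"
    and post: "\<And>s'. I M s' \<Longrightarrow> agree (For x b P) s s' \<Longrightarrow> Q s'"
  shows "halts N (For x b P) s Q"
proof -
  define L where "L = Loop (NLess (Var x) b) (Seq P (NWrite x (NConst 0) (NAdd (Var x) (NConst 1))))"
  define T where "T = bcost (NLess (Var x) b) + 1 +
    steps N (Seq P (NWrite x (NConst 0) (NAdd (Var x) (NConst 1))))"
  \<comment> \<open>\<open>d\<close> is the number of rounds left; the last summand pays for the
    test that fails.\<close>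
  have loop: "\<exists>t s''. runs L s' t s'' \<and> t \<le> d * T + (bcost (NLess (Var x) b) + 1) \<and> Q s''"
    if "I i s'" "nats s' x 0 = i" "agree (For x b P) s s'" "i + d = M" for i d s'
    using that
  proof (induction d arbitrary: i s')
    case 0
    then have "\<not> bval (NLess (Var x) b) s'" using bound[of s'] by simp
    then show ?case using runs.LoopFalse 0 post unfolding L_def by fastforce
  next
    case (Suc d)
    have b: "bval (NLess (Var x) b) s'" using bound[of s'] Suc by simp
    obtain t u where t: "runs P s' t u" "t \<le> steps N P" "I (Suc i) (nwrite x 0 (Suc i) u)"
      using step[of i s'] Suc.prems unfolding halts_def by auto
    have u: "agree P s' u" using runs_agree[OF t(1)] .
    then have xi: "nats u x 0 = i" using agreeD(1)[OF u x] Suc by simp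
    let ?u = "nwrite x 0 (Suc i) u"
    have "agree (For x b P) s' ?u" using u
      by (auto simp: agree_def nats_nwrite_other)
    then have "agree (For x b P) s ?u" using agree_trans Suc.prems(3) by blast
    then obtain t' s'' where t': "runs L ?u t' s''" "t' \<le> d * T + (bcost (NLess (Var x) b) + 1)" "Q s''"
      using Suc.IH[of "Suc i" ?u] t(3) Suc.prems(4) by auto
    \<comment> \<open>The increment costs 1 for the index, 4 for the sum and 1 for the
      write.\<close>
    have "runs (NWrite x (NConst 0) (NAdd (Var x) (NConst 1))) u 6 ?u"
      using runs.NWrite[of x "NConst 0" "NAdd (Var x) (NConst 1)" u] xi
      by (simp add: numeral_eq_Suc)
    from runs.LoopTrue[OF b runs.Seq[OF t(1) this] t'(1)[unfolded L_def]]
    have "runs L s' (bcost (NLess (Var x) b) + 1 + (t + 6) + t') s''" unfolding L_def .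
    moreover have "bcost (NLess (Var x) b) + 1 + (t + 6) + t' \<le> Suc d * T + (bcost (NLess (Var x) b) + 1)"
      using t(2) t'(2) by (simp add: T_def)
    ultimately show ?case using t'(3) by blast
  qed
  let ?s = "nwrite x 0 0 s"
  have "agree (For x b P) s ?s" by (auto simp: agree_def nats_nwrite_other)
  then obtain t s'' where t: "runs L ?s t s''" "t \<le> M * T + (bcost (NLess (Var x) b) + 1)" "Q s''"
    using loop[OF init, of M] by auto
  have "halts N L ?s Q"
    unfolding halts_def
  proof (intro exI conjI)
    have "M * T \<le> N * T" using N by simp
    then show "t \<le> steps N L" using t(2) unfolding L_def T_def by simp
  qed (use t in auto)
  then show ?thesis
    unfolding For_def L_def by (intro halts_Seq halts_NWrite) simp
qed

section \<open>The program\<close>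

text \<open>The entry for vertex \<open>v\<close> and cardinality \<open>k\<close> is stored in cell \<open>v * n + k\<close> of \<open>''f''\<close>, and
  the cells \<open>q * (n * n) + (v * n + k)\<close> of \<open>''sol''\<close> are the characteristic vector of its solution.
  As the machine cannot multiply natural numbers, the multiples of \<open>n\<close> and of \<open>n * n\<close> are
  tabulated beforehand.\<close>

definition address_com :: com where
  "address_com = Seq
    (For ''i'' (Var ''n'') (NWrite ''row'' (NAdd (Var ''i'') (NConst 1))
      (NAdd (NRead ''row'' (Var ''i'')) (Var ''n''))))
    (For ''i'' (Var ''n'') (NWrite ''block'' (NAdd (Var ''i'') (NConst 1))
      (NAdd (NRead ''block'' (Var ''i'')) (NRead ''row'' (Var ''n'')))))"

abbreviation RVar :: "string \<Rightarrow> rexp" where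
  "RVar x \<equiv> RRead x (NConst 0)"

text \<open>Only the empty set is available at first. Its entry keeps the initial memory value 0;
  all other cardinalities get the marker \<beta> + 1.\<close>

definition start_com :: com where
  "start_com = For ''i'' (Var ''n'') (For ''k'' (Var ''n'')
    (Cond (NLess (NConst 0) (Var ''k''))
      (RWrite ''f'' (NAdd (NRead ''row'' (Var ''i'')) (Var ''k'')) (RAdd (RVar ''beta'') ROne))
      Skip))"

text \<open>Run with both orders of the arrays, since the ends of an input edge come in arbitrary
  order. Slot \<open>i\<close> is overwritten by every crossing edge met, so the last one
  stays.\<close>

definition link_com :: "string \<Rightarrow> string \<Rightarrow> com" where
  "link_com a b = Cond (Conj (NLess (NConst 0) (NRead ''mark'' (NRead a (Var ''j''))))
      (Neg (NLess (NConst 0) (NRead ''mark'' (NRead b (Var ''j''))))))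
    (Seq (NWrite ''ord'' (Var ''i'') (Var ''j''))
    (Seq (NWrite ''par'' (Var ''i'') (NRead a (Var ''j'')))
      (NWrite ''chd'' (Var ''i'') (NRead b (Var ''j'')))))
    Skip"

definition scan_com :: com where
  "scan_com = For ''j'' (Var ''m'') (Seq (link_com ''src'' ''dst'') (link_com ''dst'' ''src''))"

definition grow_com :: com where
  "grow_com = Seq (NWrite ''mark'' (NConst 0) (NConst 1))
    (For ''i'' (NSub (Var ''n'') (NConst 1))
      (Seq scan_com (NWrite ''mark'' (NRead ''chd'' (Var ''i'')) (NConst 1))))"

text \<open>Once \<open>h\<close> edges on the parent side and the choice \<open>b\<close> are
  fixed, the number \<open>l\<close> on the child side is forced. An entry therefore costs linear
  rather than quadratic time.\<close>

definition try_com :: "bool \<Rightarrow> com" where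
  "try_com b = Cond (NLess (NAdd (Var ''h'') (NConst (of_bool b))) (NAdd (Var ''k'') (NConst 1)))
    (Seq (NWrite ''l'' (NConst 0) (NSub (NSub (Var ''k'') (Var ''h'')) (NConst (of_bool b))))
    (Seq (RWrite ''x'' (NConst 0) (RRead ''f'' (NAdd (Var ''p'') (Var ''h''))))
    (Seq (RWrite ''z'' (NConst 0) (RRead ''f'' (NAdd (Var ''c'') (Var ''l''))))
    (Seq (RWrite ''y'' (NConst 0) (RAdd (RVar ''z'') (RRead ''w'' (NConst (of_bool b)))))
    (Cond (Conj (Neg (RLess (RVar ''beta'') (RVar ''x'')))
          (Conj (Neg (RLess (RVar ''beta'') (RVar ''z'')))
            (Neg (RLess (RVar ''beta'') (RAdd (RVar ''x'') (RVar ''y''))))))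
      (Seq (Cond (RLess (RVar ''x'') (RVar ''y'')) (RWrite ''x'' (NConst 0) (RVar ''y'')) Skip)
        (Cond (RLess (RVar ''x'') (RVar ''best''))
          (Seq (RWrite ''best'' (NConst 0) (RVar ''x''))
          (Seq (NWrite ''a'' (NConst 0) (Var ''h''))
          (Seq (NWrite ''b'' (NConst 0) (Var ''l''))
            (NWrite ''d'' (NConst 0) (NConst (of_bool b))))))
          Skip))
      Skip)))))
    Skip"

definition best_com :: com where
  "best_com = For ''h'' (NAdd (Var ''k'') (NConst 1)) (Seq (try_com False) (try_com True))"

definition sol_at :: "string \<Rightarrow> string \<Rightarrow> string \<Rightarrow> nexp" where
  "sol_at q v k = NAdd (NRead ''block'' (Var q)) (NAdd (Var v) (Var k))"

text \<open>Addition plays the role of union: only whether a cell is nonzero is ever used.\<close>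

definition copy_com :: com where
  "copy_com = For ''q'' (Var ''m'') (NWrite ''sol'' (sol_at ''q'' ''p'' ''k'')
    (NAdd (NRead ''sol'' (sol_at ''q'' ''p'' ''a'')) (NRead ''sol'' (sol_at ''q'' ''c'' ''b''))))"

text \<open>The cardinalities are processed in descending order, so that the entries of the parent
  can be overwritten in place: the new entry for \<open>k\<close> depends on old entries up to \<open>k\<close> only.\<close>

definition merge_com :: com where
  "merge_com = For ''j'' (Var ''n'')
    (Seq (NWrite ''k'' (NConst 0) (NSub (NSub (Var ''n'') (NConst 1)) (Var ''j'')))
    (Seq (RWrite ''best'' (NConst 0) (RAdd (RVar ''beta'') ROne))
    (Seq (NWrite ''a'' (NConst 0) (NConst 0))
    (Seq (NWrite ''b'' (NConst 0) (NConst 0))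
    (Seq (NWrite ''d'' (NConst 0) (NConst 0))
    (Seq best_com
    (Seq (RWrite ''f'' (NAdd (Var ''p'') (Var ''k'')) (RVar ''best''))
    (Seq copy_com
      (NWrite ''sol'' (sol_at ''e'' ''p'' ''k'')
        (NAdd (NRead ''sol'' (sol_at ''e'' ''p'' ''k'')) (Var ''d'')))))))))))"

text \<open>The slots are processed downwards, so that the vertex grown last is absorbed first and
  is a leaf at that moment. Cells 1 and 0 of \<open>''w''\<close> hold the charges of the edge if
  contracted and if not.\<close>

definition absorb_com :: com where
  "absorb_com = For ''i'' (NSub (Var ''n'') (NConst 1))
    (Seq (NWrite ''r'' (NConst 0) (NSub (NSub (Var ''n'') (NConst 2)) (Var ''i'')))
    (Seq (NWrite ''p'' (NConst 0) (NRead ''row'' (NRead ''par'' (Var ''r''))))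
    (Seq (NWrite ''c'' (NConst 0) (NRead ''row'' (NRead ''chd'' (Var ''r''))))
    (Seq (NWrite ''e'' (NConst 0) (NRead ''ord'' (Var ''r'')))
    (Seq (RWrite ''w'' (NConst 1) (RDiv (RRead ''len'' (Var ''e'')) (RVar ''alpha'')))
    (Seq (RWrite ''w'' (NConst 0) (RSub (RRead ''w'' (NConst 1)) (RRead ''len'' (Var ''e''))))
      merge_com))))))"

text \<open>The root is vertex 0, so its row starts at cell 0. Ascending order leaves the largest
  feasible cardinality in \<open>''a''\<close>.\<close>

definition select_com :: com where
  "select_com = For ''k'' (Var ''n'')
    (Cond (RLess (RVar ''beta'') (RRead ''f'' (Var ''k''))) Skip (NWrite ''a'' (NConst 0) (Var ''k'')))"

definition output_com :: com where
  "output_com = For ''q'' (Var ''m'')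
    (NWrite ''out'' (Var ''q'') (NRead ''sol'' (NAdd (NRead ''block'' (Var ''q'')) (Var ''a''))))"

definition contraction_com :: com where
  "contraction_com = Seq address_com (Seq start_com (Seq grow_com (Seq absorb_com
    (Seq select_com output_com))))"

lemmas com_defs = address_com_def start_com_def link_com_def scan_com_def grow_com_def try_com_def
  best_com_def copy_com_def merge_com_def absorb_com_def select_com_def output_com_def

text \<open>The source of the exponent: absorbed vertex, entry in the row of its parent, and split
  of that entry. Copying a solution is a loop at the same depth as the splits.\<close>

lemma loop_depth_contraction_com: "loop_depth contraction_com = 3"
  by (simp add: contraction_com_def com_defs)

lemma nat_writes_com [simp]:
  "nat_writes address_com = {''i'', ''row'', ''block''}"
  "nat_writes start_com = {''i'', ''k''}"
  "nat_writes (link_com a b) = {''ord'', ''par'', ''chd''}"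
  "nat_writes scan_com = {''j'', ''ord'', ''par'', ''chd''}"
  "nat_writes grow_com = {''mark'', ''i'', ''j'', ''ord'', ''par'', ''chd''}"
  "nat_writes (try_com t) = {''l'', ''a'', ''b'', ''d''}"
  "nat_writes best_com = {''h'', ''l'', ''a'', ''b'', ''d''}"
  "nat_writes copy_com = {''q'', ''sol''}"
  "nat_writes merge_com = {''j'', ''k'', ''h'', ''l'', ''a'', ''b'', ''d'', ''q'', ''sol''}"
  "nat_writes absorb_com =
    {''i'', ''r'', ''p'', ''c'', ''e'', ''j'', ''k'', ''h'', ''l'', ''a'', ''b'', ''d'', ''q'', ''sol''}"
  "nat_writes select_com = {''k'', ''a''}"
  "nat_writes output_com = {''q'', ''out''}"
  by (simp_all add: com_defs insert_commute)

lemma real_writes_com [simp]: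
  "real_writes address_com = {}"
  "real_writes start_com = {''f''}"
  "real_writes (link_com a b) = {}"
  "real_writes scan_com = {}"
  "real_writes grow_com = {}"
  "real_writes (try_com t) = {''x'', ''y'', ''z'', ''best''}"
  "real_writes best_com = {''x'', ''y'', ''z'', ''best''}"
  "real_writes copy_com = {}"
  "real_writes merge_com = {''x'', ''y'', ''z'', ''best'', ''f''}"
  "real_writes absorb_com = {''w'', ''x'', ''y'', ''z'', ''best'', ''f''}"
  "real_writes select_com = {}"
  "real_writes output_com = {}"
  by (simp_all add: com_defs insert_commute)

section \<open>Correctness of the program\<close>

lemma cell_inj:
  fixes n :: nat
  assumes "k < n" "k' < n"
  shows "v * n + k = v' * n + k' \<longleftrightarrow> v = v' \<and> k = k'"
proof
  assume eq: "v * n + k = v' * n + k'"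
  have "v = (v * n + k) div n" "v' = (v' * n + k') div n" using assms by auto
  then have "v = v'" using eq by simp
  then show "v = v' \<and> k = k'" using eq by simp
qed simp

lemma cell_less:
  fixes n :: nat
  assumes "v < n" "k < n"
  shows "v * n + k < n * n"
proof -
  have "v * n + k < Suc v * n" using assms by simp
  also have "\<dots> \<le> n * n" using assms by (intro mult_le_mono1) simp
  finally show ?thesis .
qed

lemmas halts_intros = halts_Seq halts_NWrite halts_RWrite halts_Cond halts_Skip

locale tree_instance =
  fixes n :: nat and E :: "nat set set" and len :: "nat set \<Rightarrow> real" and \<alpha> \<beta> :: real
    and es :: "(nat \<times> nat) list"
  assumes tree: "is_tree {..<n} E" and len_pos: "\<forall>e\<in>E. 0 < len e"
    and \<alpha>: "1 \<le> \<alpha>" and \<beta>: "0 \<le> \<beta>" and es: "enumerates_edges es E"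
begin

abbreviation m :: nat where "m \<equiv> length es"

definition edge :: "nat \<Rightarrow> nat set" where
  "edge q = edge_of (es ! q)"

lemma edge_in: "q < m \<Longrightarrow> edge q \<in> E"
  using es by (auto simp: edge_def enumerates_edges_def)

lemma edge_ex: "e \<in> E \<Longrightarrow> \<exists>q<m. e = edge q"
  using es by (auto simp: edge_def enumerates_edges_def in_set_conv_nth) metis

lemma edge_ends: "edge q = {fst (es ! q), snd (es ! q)}"
  by (simp add: edge_def edge_of_def)

lemma ends:
  assumes "q < m"
  shows "fst (es ! q) < n" "snd (es ! q) < n"
proof -
  obtain u v where "u < n" "v < n" "edge q = {u, v}"
    using edge_in[OF assms] tree unfolding is_tree_def simple_graph_def by fastforce
  then show "fst (es ! q) < n" "snd (es ! q) < n"
    unfolding edge_ends by (auto simp: doubleton_eq_iff)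
qed

lemma m_less: "m < n"
proof -
  have "card E = m" using es unfolding enumerates_edges_def
    by (metis distinct_card length_map)
  then show ?thesis using tree_card_edges[OF tree] by simp
qed

definition loaded :: "state \<Rightarrow> bool" where
  "loaded s \<longleftrightarrow> nats s ''n'' 0 = n \<and> nats s ''m'' 0 = m \<and>
     (\<forall>q<m. nats s ''src'' q = fst (es ! q) \<and> nats s ''dst'' q = snd (es ! q) \<and>
       reals s ''len'' q = len (edge q)) \<and>
     reals s ''alpha'' 0 = \<alpha> \<and> reals s ''beta'' 0 = \<beta>"

definition addressed :: "state \<Rightarrow> bool" where
  "addressed s \<longleftrightarrow> (\<forall>i\<le>n. nats s ''row'' i = i * n \<and> nats s ''block'' i = i * (n * n))"

lemma loadedD:
  assumes "loaded s"
  shows "nats s ''n'' 0 = n" "nats s ''m'' 0 = m"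
    "q < m \<Longrightarrow> nats s ''src'' q = fst (es ! q)" "q < m \<Longrightarrow> nats s ''dst'' q = snd (es ! q)"
    "q < m \<Longrightarrow> reals s ''len'' q = len (edge q)"
    "reals s ''alpha'' 0 = \<alpha>" "reals s ''beta'' 0 = \<beta>"
  using assms by (auto simp: loaded_def)

lemma addressedD:
  assumes "addressed s" "i \<le> n"
  shows "nats s ''row'' i = i * n" "nats s ''block'' i = i * (n * n)"
  using assms by (auto simp: addressed_def)

lemma loaded_agree:
  assumes "agree P s s'" "loaded s" "nat_writes P \<inter> {''n'', ''m'', ''src'', ''dst''} = {}"
    "real_writes P \<inter> {''len'', ''alpha'', ''beta''} = {}"
  shows "loaded s'"
proof -
  have "nats s' ''n'' = nats s ''n''" "nats s' ''m'' = nats s ''m''" "nats s' ''src'' = nats s ''src''"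
    "nats s' ''dst'' = nats s ''dst''"
    using assms(3) by (auto intro!: agreeD(1)[OF assms(1)])
  moreover have "reals s' ''len'' = reals s ''len''" "reals s' ''alpha'' = reals s ''alpha''"
    "reals s' ''beta'' = reals s ''beta''"
    using assms(4) by (auto intro!: agreeD(2)[OF assms(1)])
  ultimately show ?thesis using assms(2) by (simp add: loaded_def)
qed

lemma addressed_agree:
  assumes "agree P s s'" "addressed s" "nat_writes P \<inter> {''row'', ''block''} = {}"
  shows "addressed s'"
proof -
  have "nats s' ''row'' = nats s ''row''" "nats s' ''block'' = nats s ''block''"
    using assms(3) by (auto intro!: agreeD(1)[OF assms(1)])
  then show ?thesis using assms(2) by (simp add: addressed_def)
qed

section \<open>The memory read as a table of charges and solutions\<close>

definition F :: "state \<Rightarrow> nat \<Rightarrow> nat \<Rightarrow> real" where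
  "F s v k = reals s ''f'' (v * n + k)"

lemma F_write [simp]:
  "F (nwrite a i x s) = F s"
  "k < n \<Longrightarrow> k' < n \<Longrightarrow>
    F (rwrite ''f'' (v * n + k) y s) v' k' = (if v' = v \<and> k' = k then y else F s v' k')"
  "a \<noteq> ''f'' \<Longrightarrow> F (rwrite a i y s) = F s"
  by (auto simp: F_def cell_inj fun_eq_iff)

definition mult :: "state \<Rightarrow> nat \<Rightarrow> nat \<Rightarrow> nat \<Rightarrow> nat" where
  "mult s q v k = nats s ''sol'' (q * (n * n) + (v * n + k))"

lemma mult_write [simp]:
  "v < n \<Longrightarrow> k < n \<Longrightarrow> v' < n \<Longrightarrow> k' < n \<Longrightarrow>
    mult (nwrite ''sol'' (q * (n * n) + (v * n + k)) x s) q' v' k' =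
      (if q' = q \<and> v' = v \<and> k' = k then x else mult s q' v' k')"
  "a \<noteq> ''sol'' \<Longrightarrow> mult (nwrite a i x s) = mult s"
  "mult (rwrite b i y s) = mult s"
  by (auto simp: mult_def cell_inj cell_less fun_eq_iff)

definition G :: "state \<Rightarrow> nat \<Rightarrow> nat \<Rightarrow> nat set set" where
  "G s v k = edge ` {q. q < m \<and> mult s q v k \<noteq> 0}"

subsection \<open>Initialisation\<close>

lemma address_com:
  assumes "loaded s" "nats s ''row'' 0 = 0" "nats s ''block'' 0 = 0"
  shows "halts n address_com s addressed"
  unfolding address_com_def
proof (rule halts_Seq, rule halts_For[where M = n and I = "\<lambda>i s'. \<forall>j\<le>i. nats s' ''row'' j = j * n"])
  let ?P = "For ''i'' (Var ''n'') (NWrite ''row'' (NAdd (Var ''i'') (NConst 1))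
      (NAdd (NRead ''row'' (Var ''i'')) (Var ''n'')))"
  show "nval (Var ''n'') s' = n" if "agree ?P s s'" for s'
    using agreeD(1)[OF that, of "''n''"] assms by (simp add: loadedD)
  show "halts n (NWrite ''row'' (NAdd (Var ''i'') (NConst 1))
      (NAdd (NRead ''row'' (Var ''i'')) (Var ''n''))) s'
     (\<lambda>s''. \<forall>j\<le>Suc i. nats (nwrite ''i'' 0 (Suc i) s'') ''row'' j = j * n)"
    if "\<forall>j\<le>i. nats s' ''row'' j = j * n" "nats s' ''i'' 0 = i" "agree ?P s s'" for i s'
    using that(1,2) agreeD(1)[OF that(3), of "''n''"] assms
    by (intro halts_intros) (auto simp: loadedD le_Suc_eq)
  fix s1
  assume row: "\<forall>j\<le>n. nats s1 ''row'' j = j * n" and s1: "agree ?P s s1"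
  let ?R = "For ''i'' (Var ''n'') (NWrite ''block'' (NAdd (Var ''i'') (NConst 1))
      (NAdd (NRead ''block'' (Var ''i'')) (NRead ''row'' (Var ''n''))))"
  have n: "nats s1 ''n'' 0 = n" "nats s1 ''block'' 0 = 0"
    using agreeD(1)[OF s1, of "''n''"] agreeD(1)[OF s1, of "''block''"] assms by (simp_all add: loadedD)
  show "halts n ?R s1 addressed"
  proof (rule halts_For[where M = n and I = "\<lambda>i s'. \<forall>j\<le>i. nats s' ''block'' j = j * (n * n)"])
    fix s'
    assume s': "agree ?R s1 s'"
    then have eq: "nats s' ''n'' = nats s1 ''n''" "nats s' ''row'' = nats s1 ''row''"
      by (auto intro!: agreeD(1))
    show "nval (Var ''n'') s' = n" using eq n by simp
    show "halts n (NWrite ''block'' (NAdd (Var ''i'') (NConst 1))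
        (NAdd (NRead ''block'' (Var ''i'')) (NRead ''row'' (Var ''n'')))) s'
       (\<lambda>s''. \<forall>j\<le>Suc i. nats (nwrite ''i'' 0 (Suc i) s'') ''block'' j = j * (n * n))"
      if "\<forall>j\<le>i. nats s' ''block'' j = j * (n * n)" "nats s' ''i'' 0 = i" for i
      using that eq n row by (intro halts_intros) (auto simp: le_Suc_eq)
    show "addressed s'" if "\<forall>j\<le>n. nats s' ''block'' j = j * (n * n)"
      using that eq row by (simp add: addressed_def)
  qed (use n in auto)
qed (use assms in auto)

lemma start_com:
  assumes "loaded s" "addressed s" "reals s ''f'' = (\<lambda>_. 0)"
  shows "halts n start_com s (\<lambda>s'. \<forall>v<n. \<forall>k<n. F s' v k = (if k = 0 then 0 else \<beta> + 1))"
  unfolding start_com_def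
proof (rule halts_For[where M = n and
    I = "\<lambda>i s'. \<forall>v<n. \<forall>k<n. F s' v k = (if k \<noteq> 0 \<and> v < i then \<beta> + 1 else 0)"])
  let ?B = "Cond (NLess (NConst 0) (Var ''k''))
      (RWrite ''f'' (NAdd (NRead ''row'' (Var ''i'')) (Var ''k'')) (RAdd (RVar ''beta'') ROne)) Skip"
  let ?R = "For ''k'' (Var ''n'') ?B"
  let ?P = "For ''i'' (Var ''n'') ?R"
  fix s' assume s': "agree ?P s s'"
  have ld: "loaded s'" by (rule loaded_agree[OF s' assms(1)]) auto
  have ad: "addressed s'" by (rule addressed_agree[OF s' assms(2)]) auto
  show "nval (Var ''n'') s' = n" using ld by (simp add: loadedD)
  fix i assume i: "i < n" "nats s' ''i'' 0 = i"
    and I: "\<forall>v<n. \<forall>k<n. F s' v k = (if k \<noteq> 0 \<and> v < i then \<beta> + 1 else 0)"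
  show "halts n ?R s' (\<lambda>s''. \<forall>v<n. \<forall>k<n. F (nwrite ''i'' 0 (Suc i) s'') v k =
      (if k \<noteq> 0 \<and> v < Suc i then \<beta> + 1 else 0))"
  proof (rule halts_For[where M = n and I = "\<lambda>l s'. \<forall>v<n. \<forall>k<n. F s' v k =
      (if k \<noteq> 0 \<and> (v < i \<or> v = i \<and> k < l) then \<beta> + 1 else 0)"])
    fix s'' assume s'': "agree ?R s' s''"
    have ld': "loaded s''" by (rule loaded_agree[OF s'' ld]) auto
    have ad': "addressed s''" by (rule addressed_agree[OF s'' ad]) auto
    have i': "nats s'' ''i'' 0 = i" using agreeD(1)[OF s'', of "''i''"] i by simp
    show "nval (Var ''n'') s'' = n" using ld' by (simp add: loadedD)
    show "halts n ?B s'' (\<lambda>u. \<forall>v<n. \<forall>k<n. F (nwrite ''k'' 0 (Suc l) u) v k =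
        (if k \<noteq> 0 \<and> (v < i \<or> v = i \<and> k < Suc l) then \<beta> + 1 else 0))"
      if "l < n" "\<forall>v<n. \<forall>k<n. F s'' v k = (if k \<noteq> 0 \<and> (v < i \<or> v = i \<and> k < l) then \<beta> + 1 else 0)"
        "nats s'' ''k'' 0 = l" for l
      using that i' i(1) by (intro halts_intros)
        (auto simp: loadedD[OF ld'] addressedD[OF ad'] less_Suc_eq)
    show "\<forall>v<n. \<forall>k<n. F (nwrite ''i'' 0 (Suc i) s'') v k =
        (if k \<noteq> 0 \<and> v < Suc i then \<beta> + 1 else 0)"
      if "\<forall>v<n. \<forall>k<n. F s'' v k = (if k \<noteq> 0 \<and> (v < i \<or> v = i \<and> k < n) then \<beta> + 1 else 0)"
      using that by (auto simp: less_Suc_eq)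
  qed (use I in auto)
qed (use assms in \<open>auto simp: F_def\<close>)

subsection \<open>Growing the tree\<close>

text \<open>The arrays are filled oldest first; \<open>rev\<close> restores the order of
  \<open>grown\<close>.\<close>

definition grown_list :: "state \<Rightarrow> nat \<Rightarrow> (nat \<times> nat) list" where
  "grown_list s i = map (\<lambda>j. (nats s ''par'' j, nats s ''chd'' j)) (rev [0..<i])"

lemma grown_list_simps [simp]:
  "grown_list s 0 = []"
  "grown_list s (Suc i) = (nats s ''par'' i, nats s ''chd'' i) # grown_list s i"
  by (auto simp: grown_list_def)

lemma length_grown_list [simp]: "length (grown_list s i) = i"
  by (simp add: grown_list_def)

lemma grown_list_cong:
  "(\<And>j. j < i \<Longrightarrow> nats s ''par'' j = nats s' ''par'' j \<and> nats s ''chd'' j = nats s' ''chd'' j) \<Longrightarrow>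
    grown_list s i = grown_list s' i"
  by (simp add: grown_list_def)

definition grows :: "nat \<Rightarrow> state \<Rightarrow> bool" where
  "grows i s \<longleftrightarrow> grown 0 (grown_list s i) \<and> verts 0 (grown_list s i) \<subseteq> {..<n} \<and>
     edges (grown_list s i) \<subseteq> E \<and>
     (\<forall>j<i. nats s ''ord'' j < m \<and> edge (nats s ''ord'' j) = {nats s ''par'' j, nats s ''chd'' j}) \<and>
     (\<forall>v<n. nats s ''mark'' v \<noteq> 0 \<longleftrightarrow> v \<in> verts 0 (grown_list s i))"

definition crossing :: "state \<Rightarrow> nat set \<Rightarrow> nat \<Rightarrow> nat \<Rightarrow> bool" where
  "crossing s e u v \<longleftrightarrow> u < n \<and> v < n \<and> e = {u, v} \<and> nats s ''mark'' u \<noteq> 0 \<and> nats s ''mark'' v = 0"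

definition link :: "nat \<Rightarrow> nat \<Rightarrow> nat \<Rightarrow> nat \<Rightarrow> state \<Rightarrow> state" where
  "link i j u v s = nwrite ''chd'' i v (nwrite ''par'' i u (nwrite ''ord'' i j s))"

lemma link_com:
  assumes "nats s ''i'' 0 = i" "nats s ''j'' 0 = j" "nats s a j = u" "nats s b j = v"
    "a \<notin> {''ord'', ''par'', ''chd''}" "b \<notin> {''ord'', ''par'', ''chd''}"
  shows "halts n (link_com a b) s
    (\<lambda>s'. s' = (if nats s ''mark'' u \<noteq> 0 \<and> nats s ''mark'' v = 0 then link i j u v s else s))"
  unfolding link_com_def using assms by (intro halts_intros) (auto simp: link_def)

text \<open>The scan does not write marks, so crossing can be judged in the state \<open>s\<close>
  before it, whatever slot \<open>i\<close> held in between.\<close>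

lemma scan_com:
  assumes "loaded s" "nats s ''i'' 0 = i"
  shows "halts n scan_com s (\<lambda>s'.
    (\<forall>l. l \<noteq> i \<longrightarrow> nats s' ''ord'' l = nats s ''ord'' l \<and> nats s' ''par'' l = nats s ''par'' l \<and>
      nats s' ''chd'' l = nats s ''chd'' l) \<and>
    ((\<exists>q<m. \<exists>u v. crossing s (edge q) u v) \<longrightarrow> nats s' ''ord'' i < m \<and>
      crossing s (edge (nats s' ''ord'' i)) (nats s' ''par'' i) (nats s' ''chd'' i)))"
  unfolding scan_com_def
proof (rule halts_For[where M = m and I = "\<lambda>j s'.
    (\<forall>l. l \<noteq> i \<longrightarrow> nats s' ''ord'' l = nats s ''ord'' l \<and> nats s' ''par'' l = nats s ''par'' l \<and>
      nats s' ''chd'' l = nats s ''chd'' l) \<and>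
    ((\<exists>q<j. \<exists>u v. crossing s (edge q) u v) \<longrightarrow> nats s' ''ord'' i < m \<and>
      crossing s (edge (nats s' ''ord'' i)) (nats s' ''par'' i) (nats s' ''chd'' i))"])
  let ?B = "Seq (link_com ''src'' ''dst'') (link_com ''dst'' ''src'')"
  let ?P = "For ''j'' (Var ''m'') ?B"
  fix s' assume s': "agree ?P s s'"
  have ld: "loaded s'" by (rule loaded_agree[OF s' assms(1)]) auto
  have eq: "nats s' ''i'' 0 = i" "nats s' ''mark'' = nats s ''mark''"
    using agreeD(1)[OF s', of "''i''"] agreeD(1)[OF s', of "''mark''"] assms by simp_all
  show "nval (Var ''m'') s' = m" using ld by (simp add: loadedD)
  fix j
  let ?I = "\<lambda>j s'.
    (\<forall>l. l \<noteq> i \<longrightarrow> nats s' ''ord'' l = nats s ''ord'' l \<and> nats s' ''par'' l = nats s ''par'' l \<and>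
      nats s' ''chd'' l = nats s ''chd'' l) \<and>
    ((\<exists>q<j. \<exists>u v. crossing s (edge q) u v) \<longrightarrow> nats s' ''ord'' i < m \<and>
      crossing s (edge (nats s' ''ord'' i)) (nats s' ''par'' i) (nats s' ''chd'' i))"
  assume j: "j < m" "nats s' ''j'' 0 = j" and I: "?I j s'"
  let ?u = "fst (es ! j)" and ?v = "snd (es ! j)"
  let ?c = "\<lambda>u v. nats s ''mark'' u \<noteq> 0 \<and> nats s ''mark'' v = 0"
  have uv: "nats s' ''src'' j = ?u" "nats s' ''dst'' j = ?v" using loadedD(3,4)[OF ld j(1)] by simp_all
  define t where "t = (if ?c ?u ?v then link i j ?u ?v s' else s')"
  define t' where "t' = (if ?c ?v ?u then link i j ?v ?u t else t)"
  have fr: "nats t ''i'' 0 = i" "nats t ''j'' 0 = j" "nats t ''src'' j = ?u" "nats t ''dst'' j = ?v"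
      "nats t ''mark'' = nats s ''mark''"
    using eq j uv by (auto simp: t_def link_def fun_eq_iff)
  have "?I (Suc j) (nwrite ''j'' 0 (Suc j) t')"
  proof -
    consider (uv) "?c ?u ?v" "t' = link i j ?u ?v s'" | (vu) "?c ?v ?u" "t' = link i j ?v ?u s'"
      | (none) "\<not> ?c ?u ?v" "\<not> ?c ?v ?u" "t' = s'"
      unfolding t'_def t_def by argo
    then show ?thesis
    proof cases
      case uv
      then have "crossing s (edge j) ?u ?v" using ends[OF j(1)] edge_ends by (simp add: crossing_def)
      then show ?thesis using I j(1) unfolding uv(2) by (auto simp: link_def)
    next
      case vu
      then have "crossing s (edge j) ?v ?u"
        using ends[OF j(1)] edge_ends[of j] by (simp add: crossing_def insert_commute)
      then show ?thesis using I j(1) unfolding vu(2) by (auto simp: link_def)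
    next
      case none
      then have "\<not> crossing s (edge j) u v" for u v
        using edge_ends[of j] by (auto simp: crossing_def doubleton_eq_iff)
      then show ?thesis using I none(3) by (auto simp: less_Suc_eq)
    qed
  qed
  moreover have "halts n (link_com ''dst'' ''src'') t (\<lambda>s'. s' = t')"
    unfolding t'_def using link_com[of t i j "''dst''" ?v "''src''" ?u] fr by simp
  moreover have "halts n (link_com ''src'' ''dst'') s' (\<lambda>s'. s' = t)"
    unfolding t_def using link_com[of s' i j "''src''" ?u "''dst''" ?v] eq j uv by simp
  ultimately show "halts n ?B s' (\<lambda>s''. ?I (Suc j) (nwrite ''j'' 0 (Suc j) s''))"
    by (intro halts_Seq) (auto elim!: halts_mono)
qed (use assms m_less in auto)

lemma grow_com:
  assumes "loaded s" "nats s ''mark'' = (\<lambda>_. 0)"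
  shows "halts n grow_com s (grows (n - 1))"
  unfolding grow_com_def
proof (intro halts_Seq halts_NWrite, rule halts_For[where M = "n - 1" and I = grows])
  have n: "0 < n" using m_less by simp
  let ?s = "nwrite ''mark'' (nval (NConst 0) s) (nval (NConst 1) s) s"
  let ?B = "Seq scan_com (NWrite ''mark'' (NRead ''chd'' (Var ''i'')) (NConst 1))"
  let ?P = "For ''i'' (NSub (Var ''n'') (NConst 1)) ?B"
  show "grows 0 (nwrite ''i'' 0 0 ?s)" using n assms(2) by (auto simp: grows_def)
  have ld0: "loaded ?s" using assms by (simp add: loaded_def)
  fix s' assume s': "agree ?P ?s s'"
  have ld: "loaded s'" by (rule loaded_agree[OF s' ld0]) auto
  show "nval (NSub (Var ''n'') (NConst 1)) s' = n - 1" using ld by (simp add: loadedD)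
  fix i assume i: "i < n - 1" "nats s' ''i'' 0 = i" and I: "grows i s'"
  note g = I[unfolded grows_def]
  let ?xs = "grown_list s' i"
  show "halts n ?B s' (\<lambda>s''. grows (Suc i) (nwrite ''i'' 0 (Suc i) s''))"
  proof (intro halts_Seq, rule halts_use[OF scan_com[OF ld i(2)]], intro halts_NWrite)
    fix u assume u: "agree scan_com s' u" and scan:
      "(\<forall>l. l \<noteq> i \<longrightarrow> nats u ''ord'' l = nats s' ''ord'' l \<and> nats u ''par'' l = nats s' ''par'' l \<and>
        nats u ''chd'' l = nats s' ''chd'' l) \<and>
      ((\<exists>q<m. \<exists>u v. crossing s' (edge q) u v) \<longrightarrow> nats u ''ord'' i < m \<and>
        crossing s' (edge (nats u ''ord'' i)) (nats u ''par'' i) (nats u ''chd'' i))"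
    \<comment> \<open>With only \<open>i + 1 < n\<close> vertices grown, connectivity supplies a
      crossing edge, so the scan cannot fail.\<close>
    have "card (verts 0 ?xs) = Suc i" using card_verts[of 0 ?xs] g by simp
    moreover have "Suc i \<noteq> n" using i(1) by simp
    ultimately have "verts 0 ?xs \<noteq> {..<n}" by (metis card_lessThan)
    moreover have "is_connected {..<n} E" using tree by (simp add: is_tree_def)
    moreover have "verts 0 ?xs \<noteq> {}" by (simp add: verts_def)
    ultimately obtain a b where "a \<in> verts 0 ?xs" "b < n" "b \<notin> verts 0 ?xs" "{a, b} \<in> E"
      using crossing_edge_ex[of "{..<n}" E "verts 0 ?xs"] g by auto
    moreover from this obtain q where "q < m" "{a, b} = edge q" using edge_ex by blast
    ultimately have "crossing s' (edge q) a b" using g by (auto simp: crossing_def)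
    then have new: "nats u ''ord'' i < m"
        "crossing s' (edge (nats u ''ord'' i)) (nats u ''par'' i) (nats u ''chd'' i)"
      using scan \<open>q < m\<close> by blast+
    let ?p = "nats u ''par'' i" and ?c = "nats u ''chd'' i"
    have pc: "?p < n" "?c < n" "?p \<in> verts 0 ?xs" "?c \<notin> verts 0 ?xs"
        "edge (nats u ''ord'' i) = {?p, ?c}"
      using new(2) g by (auto simp: crossing_def)
    have xs: "grown_list u i = ?xs" using scan by (intro grown_list_cong) auto
    have i': "nats u ''i'' 0 = i" and mark: "nats u ''mark'' = nats s' ''mark''"
      using agreeD(1)[OF u, of "''i''"] agreeD(1)[OF u, of "''mark''"] i by simp_all
    have "{?p, ?c} \<in> E" using edge_in[OF new(1)] pc(5) by simp
    let ?u = "nwrite ''i'' 0 (Suc i) (nwrite ''mark'' ?c 1 u)"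
    have "grown_list ?u i = ?xs" unfolding xs[symmetric] by (rule grown_list_cong) simp
    then have "grows (Suc i) ?u"
      unfolding grows_def using g pc new(1) scan mark \<open>{?p, ?c} \<in> E\<close>
      by (auto simp: less_Suc_eq)
    then show "grows (Suc i) (nwrite ''i'' 0 (Suc i)
        (nwrite ''mark'' (nval (NRead ''chd'' (Var ''i'')) u) (nval (NConst 1) u) u))"
      using i' by simp
  qed
qed auto

lemma grows_all:
  assumes "grows (n - 1) s"
  shows "verts 0 (grown_list s (n - 1)) = {..<n}" "edges (grown_list s (n - 1)) = E"
proof -
  let ?xs = "grown_list s (n - 1)"
  have g: "grown 0 ?xs" "verts 0 ?xs \<subseteq> {..<n}" "edges ?xs \<subseteq> E" using assms by (auto simp: grows_def)
  have "card (verts 0 ?xs) = n" using card_verts[OF g(1)] m_less by simp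
  then show "verts 0 ?xs = {..<n}" using g(2) by (intro card_subset_eq) auto
  then show "edges ?xs = E" using grown_spanning[OF tree g(1)] g(3) by simp
qed

subsection \<open>Computing an entry\<close>

text \<open>\<open>V\<close> describes the pairs tried so far; the second index is determined by
  them. The bounds on \<open>i\<close> and \<open>j\<close> hold even if nothing has been found, so
  that copying never leaves the rows and reads only entries not yet replaced.\<close>

definition best_of :: "(bool \<Rightarrow> real) \<Rightarrow> (nat \<Rightarrow> real) \<Rightarrow> (nat \<Rightarrow> real) \<Rightarrow> nat \<Rightarrow>
    (nat \<Rightarrow> bool \<Rightarrow> bool) \<Rightarrow> real \<Rightarrow> nat \<Rightarrow> nat \<Rightarrow> nat \<Rightarrow> bool" where
  "best_of w f f' k V x i j d \<longleftrightarrow> 0 \<le> x \<and> i \<le> k \<and> j \<le> k \<and>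
     (\<forall>i j b. V i b \<and> candidate \<beta> w f f' k i j b \<longrightarrow> x \<le> max (f i) (f' j + w b)) \<and>
     (x \<le> \<beta> \<longrightarrow> (\<exists>b. candidate \<beta> w f f' k i j b \<and> x = max (f i) (f' j + w b) \<and> d = of_bool b))"

definition best_in :: "(bool \<Rightarrow> real) \<Rightarrow> (nat \<Rightarrow> real) \<Rightarrow> (nat \<Rightarrow> real) \<Rightarrow> nat \<Rightarrow>
    (nat \<Rightarrow> bool \<Rightarrow> bool) \<Rightarrow> state \<Rightarrow> bool" where
  "best_in w f f' k V s \<longleftrightarrow>
     best_of w f f' k V (reals s ''best'' 0) (nats s ''a'' 0) (nats s ''b'' 0) (nats s ''d'' 0)"

lemma best_of_mono:
  assumes "best_of w f f' k V x i j d"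
    "\<And>i j b. V' i b \<Longrightarrow> candidate \<beta> w f f' k i j b \<Longrightarrow> V i b"
  shows "best_of w f f' k V' x i j d"
  using assms unfolding best_of_def by blast

definition operands :: "(bool \<Rightarrow> real) \<Rightarrow> (nat \<Rightarrow> real) \<Rightarrow> (nat \<Rightarrow> real) \<Rightarrow> nat \<Rightarrow> state \<Rightarrow> bool" where
  "operands w f f' k s \<longleftrightarrow> reals s ''beta'' 0 = \<beta> \<and> nats s ''k'' 0 = k \<and>
     (\<forall>b. reals s ''w'' (of_bool b) = w b) \<and>
     (\<forall>i\<le>k. reals s ''f'' (nats s ''p'' 0 + i) = f i \<and> reals s ''f'' (nats s ''c'' 0 + i) = f' i \<and>
       0 \<le> f i)"

lemma operands_agree:
  assumes "agree P s s'" "operands w f f' k s" "nat_writes P \<inter> {''k'', ''p'', ''c''} = {}"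
    "real_writes P \<inter> {''beta'', ''w'', ''f''} = {}"
  shows "operands w f f' k s'"
proof -
  have "nats s' ''k'' = nats s ''k''" "nats s' ''p'' = nats s ''p''" "nats s' ''c'' = nats s ''c''"
    using assms(3) by (auto intro!: agreeD(1)[OF assms(1)])
  moreover have "reals s' ''beta'' = reals s ''beta''" "reals s' ''w'' = reals s ''w''"
    "reals s' ''f'' = reals s ''f''"
    using assms(4) by (auto intro!: agreeD(2)[OF assms(1)])
  ultimately show ?thesis using assms(2) by (simp add: operands_def)
qed

lemma best_of_keep:
  assumes "best_of w f f' k V x i j d"
    "\<And>l. candidate \<beta> w f f' k h l b \<Longrightarrow> x \<le> max (f h) (f' l + w b)"
  shows "best_of w f f' k (\<lambda>i b'. V i b' \<or> i = h \<and> b' = b) x i j d"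
  using assms unfolding best_of_def by blast

lemma best_of_improve:
  assumes "best_of w f f' k V x i j d" "candidate \<beta> w f f' k h l b" "0 \<le> f h"
    "max (f h) (f' l + w b) < x"
  shows "best_of w f f' k (\<lambda>i b'. V i b' \<or> i = h \<and> b' = b) (max (f h) (f' l + w b)) h l (of_bool b)"
proof -
  let ?z = "max (f h) (f' l + w b)"
  have l: "h \<le> k" "l \<le> k" and uniq: "l' = l" if "candidate \<beta> w f f' k h l' b" for l'
    using assms(2) that by (auto simp: candidate_def)
  have "?z \<le> max (f i') (f' j' + w b')"
    if "V i' b' \<or> i' = h \<and> b' = b" "candidate \<beta> w f f' k i' j' b'" for i' j' b'
    using that(1)
  proof
    assume "V i' b'"
    then have "x \<le> max (f i') (f' j' + w b')" using assms(1) that(2) unfolding best_of_def by blast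
    then show ?thesis using assms(4) by linarith
  next
    assume "i' = h \<and> b' = b"
    then show ?thesis using that(2) uniq by blast
  qed
  moreover have "0 \<le> ?z" using assms(3) by simp
  ultimately show ?thesis unfolding best_of_def using l[OF assms(2)] assms(2) by blast
qed

text \<open>Either the split is impossible and every candidate condition for it is void, or
  \<open>l\<close> is its only partner and each branch keeps or improves the recorded best.\<close>

lemma try_com:
  assumes op: "operands w f f' k s" and h: "nats s ''h'' 0 = h"
    and best: "best_in w f f' k V s"
  shows "halts n (try_com b) s (best_in w f f' k (\<lambda>i b'. V i b' \<or> i = h \<and> b' = b))"
proof (cases "h + of_bool b \<le> k")
  case False
  then have "\<not> candidate \<beta> w f f' k h j b" for j by (auto simp: candidate_def)
  then have "best_in w f f' k (\<lambda>i b'. V i b' \<or> i = h \<and> b' = b) s"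
    using best best_of_keep unfolding best_in_def by blast
  then show ?thesis
    unfolding try_com_def
    by (intro halts_Cond halts_Skip) (use False h op in \<open>simp_all add: operands_def\<close>)
next
  case True
  define l where "l = k - h - of_bool b"
  have hl: "h \<le> k" "l \<le> k" "h + l + of_bool b = k" using True by (auto simp: l_def)
  have cand: "candidate \<beta> w f f' k h j b \<longleftrightarrow>
      j = l \<and> \<not> \<beta> < f h \<and> \<not> \<beta> < f' l \<and> \<not> \<beta> < f h + (f' l + w b)" for j
    using hl by (auto simp: candidate_def)
  have vals: "reals s ''beta'' 0 = \<beta>" "nats s ''k'' 0 = k" "reals s ''w'' (of_bool b) = w b"
      "reals s ''f'' (nats s ''p'' 0 + h) = f h" "reals s ''f'' (nats s ''c'' 0 + l) = f' l"
      and nonneg: "0 \<le> f h"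
    using op hl by (auto simp: operands_def)
  let ?V = "\<lambda>i b'. V i b' \<or> i = h \<and> b' = b" and ?z = "max (f h) (f' l + w b)"
  define c where "c \<longleftrightarrow> \<not> \<beta> < f h \<and> \<not> \<beta> < f' l \<and> \<not> \<beta> < f h + (f' l + w b)"
  have keep: "best_in w f f' k ?V s'"
    if "c \<Longrightarrow> reals s ''best'' 0 \<le> ?z" "reals s' ''best'' 0 = reals s ''best'' 0"
      "nats s' ''a'' 0 = nats s ''a'' 0" "nats s' ''b'' 0 = nats s ''b'' 0"
      "nats s' ''d'' 0 = nats s ''d'' 0" for s'
    unfolding best_in_def that(2-)
    by (rule best_of_keep[OF best[unfolded best_in_def]]) (use that(1) cand c_def in auto)
  have improve: "best_in w f f' k ?V s'"
    if "c" "?z < reals s ''best'' 0" "reals s' ''best'' 0 = ?z"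
      "nats s' ''a'' 0 = h" "nats s' ''b'' 0 = l" "nats s' ''d'' 0 = of_bool b" for s'
    unfolding best_in_def that(3-)
    by (rule best_of_improve[OF best[unfolded best_in_def]]) (use that(1,2) cand c_def nonneg in auto)
  have k: "nats s ''k'' 0 = h + l + of_bool b" using vals hl by simp
  show ?thesis
    unfolding try_com_def
    apply (rule halts_Cond)
     apply (rule halts_Seq, rule halts_NWriteI[where k = l], simp, simp add: h k)
     apply (rule halts_Seq, rule halts_RWriteI[where y = "f h"], simp, simp add: h vals)
     apply (rule halts_Seq, rule halts_RWriteI[where y = "f' l"], simp, simp add: vals)
     apply (rule halts_Seq, rule halts_RWriteI[where y = "f' l + w b"], simp, simp add: vals)
     apply (intro halts_intros)
    subgoal by (rule improve) (use vals(1) h k in \<open>simp_all add: c_def\<close>)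
    subgoal by (rule keep) (use vals(1) h k in \<open>simp_all add: c_def\<close>)
    subgoal by (rule improve) (use vals(1) h k in \<open>simp_all add: c_def\<close>)
    subgoal by (rule keep) (use vals(1) h k in \<open>simp_all add: c_def\<close>)
    subgoal by (rule keep) (use vals(1) h k in \<open>simp_all add: c_def\<close>)
    subgoal using h k by simp
    done
qed

lemma best_com:
  assumes op: "operands w f f' k s" and best: "best_in w f f' k (\<lambda>_ _. False) s" and k: "k < n"
  shows "halts n best_com s (best_in w f f' k (\<lambda>_ _. True))"
  unfolding best_com_def
proof (rule halts_For[where M = "k + 1" and I = "\<lambda>h. best_in w f f' k (\<lambda>i _. i < h)"])
  let ?P = "For ''h'' (NAdd (Var ''k'') (NConst 1)) (Seq (try_com False) (try_com True))"
  show "best_in w f f' k (\<lambda>i _. i < 0) (nwrite ''h'' 0 0 s)"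
    using best by (simp add: best_in_def)
  fix s' assume s': "agree ?P s s'"
  have op': "operands w f f' k s'" by (rule operands_agree[OF s' op]) auto
  show "nval (NAdd (Var ''k'') (NConst 1)) s' = k + 1" using op' by (simp add: operands_def)
  show "best_in w f f' k (\<lambda>_ _. True) s'" if "best_in w f f' k (\<lambda>i _. i < k + 1) s'"
  proof -
    have "i < k + 1" if "candidate \<beta> w f f' k i j b" for i j b
      using that by (auto simp: candidate_def)
    then show ?thesis using that best_of_mono unfolding best_in_def by blast
  qed
  fix h assume h: "nats s' ''h'' 0 = h" and I: "best_in w f f' k (\<lambda>i _. i < h) s'"
  show "halts n (Seq (try_com False) (try_com True)) s'
     (\<lambda>s''. best_in w f f' k (\<lambda>i _. i < Suc h) (nwrite ''h'' 0 (Suc h) s''))"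
  proof (intro halts_Seq, rule halts_use[OF try_com[OF op' h I]])
    fix s1
    assume s1: "agree (try_com False) s' s1"
      and b1: "best_in w f f' k (\<lambda>i b'. i < h \<or> i = h \<and> b' = False) s1"
    have op1: "operands w f f' k s1" by (rule operands_agree[OF s1 op']) auto
    have h1: "nats s1 ''h'' 0 = h" using agreeD(1)[OF s1, of "''h''"] h by simp
    show "halts n (try_com True) s1
        (\<lambda>s''. best_in w f f' k (\<lambda>i _. i < Suc h) (nwrite ''h'' 0 (Suc h) s''))"
      by (rule halts_mono[OF try_com[OF op1 h1 b1]])
        (auto simp: best_in_def less_Suc_eq elim: best_of_mono)
  qed
qed (use k in auto)

subsection \<open>Merging two rows of the table\<close>

lemma F_agree: "agree P s s' \<Longrightarrow> ''f'' \<notin> real_writes P \<Longrightarrow> F s' = F s"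
  by (simp add: F_def fun_eq_iff agreeD(2))

lemma mult_agree: "agree P s s' \<Longrightarrow> ''sol'' \<notin> nat_writes P \<Longrightarrow> mult s' = mult s"
  by (simp add: mult_def fun_eq_iff agreeD(1))

lemma G_cong:
  assumes "\<And>q. q < m \<Longrightarrow> mult s q v k = mult s' q v k"
  shows "G s v k = G s' v k"
  using assms unfolding G_def by (intro image_cong) auto

text \<open>The target cell may itself be a source, namely if \<open>i = k\<close>. This is
  harmless: each round touches one block of \<open>n * n\<close> cells and reads it before
  writing.\<close>

lemma copy_com:
  assumes ld: "loaded s" and ad: "addressed s" and bounds: "pv < n" "cv < n" "k < n" "i < n" "j < n"
    and vars: "nats s ''p'' 0 = pv * n" "nats s ''c'' 0 = cv * n" "nats s ''k'' 0 = k"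
      "nats s ''a'' 0 = i" "nats s ''b'' 0 = j"
  shows "halts n copy_com s (\<lambda>s'. \<forall>q<m. \<forall>v<n. \<forall>l<n. mult s' q v l =
    (if v = pv \<and> l = k then mult s q pv i + mult s q cv j else mult s q v l))"
  unfolding copy_com_def
proof (rule halts_For[where M = m and I = "\<lambda>r s'. \<forall>q<m. \<forall>v<n. \<forall>l<n. mult s' q v l =
    (if q < r \<and> v = pv \<and> l = k then mult s q pv i + mult s q cv j else mult s q v l)"])
  let ?B = "NWrite ''sol'' (sol_at ''q'' ''p'' ''k'')
    (NAdd (NRead ''sol'' (sol_at ''q'' ''p'' ''a'')) (NRead ''sol'' (sol_at ''q'' ''c'' ''b'')))"
  let ?P = "For ''q'' (Var ''m'') ?B"
  fix s' assume s': "agree ?P s s'"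
  have ld': "loaded s'" by (rule loaded_agree[OF s' ld]) auto
  have ad': "addressed s'" by (rule addressed_agree[OF s' ad]) auto
  have vars': "nats s' ''p'' 0 = pv * n" "nats s' ''c'' 0 = cv * n" "nats s' ''k'' 0 = k"
      "nats s' ''a'' 0 = i" "nats s' ''b'' 0 = j"
    using vars agreeD(1)[OF s', of "''p''"] agreeD(1)[OF s', of "''c''"] agreeD(1)[OF s', of "''k''"]
      agreeD(1)[OF s', of "''a''"] agreeD(1)[OF s', of "''b''"] by simp_all
  show "nval (Var ''m'') s' = m" using ld' by (simp add: loadedD)
  fix r assume r: "r < m" "nats s' ''q'' 0 = r" and I: "\<forall>q<m. \<forall>v<n. \<forall>l<n. mult s' q v l =
      (if q < r \<and> v = pv \<and> l = k then mult s q pv i + mult s q cv j else mult s q v l)"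
  have blk: "nats s' ''block'' r = r * (n * n)" using addressedD(2)[OF ad', of r] r m_less by simp
  show "halts n ?B s' (\<lambda>s''. \<forall>q<m. \<forall>v<n. \<forall>l<n. mult (nwrite ''q'' 0 (Suc r) s'') q v l =
      (if q < Suc r \<and> v = pv \<and> l = k then mult s q pv i + mult s q cv j else mult s q v l))"
  proof (rule halts_NWriteI)
    show "nval (sol_at ''q'' ''p'' ''k'') s' = r * (n * n) + (pv * n + k)"
      using vars' r blk by (simp add: sol_at_def)
    have "nval (NAdd (NRead ''sol'' (sol_at ''q'' ''p'' ''a'')) (NRead ''sol'' (sol_at ''q'' ''c'' ''b''))) s' =
        mult s' r pv i + mult s' r cv j"
      using vars' r blk by (simp add: sol_at_def mult_def)
    then show "nval (NAdd (NRead ''sol'' (sol_at ''q'' ''p'' ''a'')) (NRead ''sol'' (sol_at ''q'' ''c'' ''b''))) s' =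
        mult s r pv i + mult s r cv j" using I r bounds by simp
  qed (use I bounds in \<open>auto simp: less_Suc_eq\<close>)
qed (use m_less in auto)

text \<open>After \<open>j\<close> rounds the entries of the parent from \<open>n - j\<close> on are
  new and everything else is old. The solutions that are still old are tracked cell by cell through
  \<open>mult\<close>, as they will be copied.\<close>

lemma merge_com:
  assumes ld: "loaded s" and ad: "addressed s" and bounds: "pv < n" "cv < n" "pv \<noteq> cv" "e < m"
    and vars: "nats s ''p'' 0 = pv * n" "nats s ''c'' 0 = cv * n" "nats s ''e'' 0 = e"
      "\<And>b. reals s ''w'' (of_bool b) = w b"
    and nonneg: "\<And>k. k < n \<Longrightarrow> 0 \<le> F s pv k"
  shows "halts n merge_com s (\<lambda>s'.
    (\<forall>k<n. merged_entry \<beta> w (edge e) (F s pv) (G s pv) (F s cv) (G s cv) k (F s' pv k) (G s' pv k)) \<and>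
    (\<forall>v<n. v \<noteq> pv \<longrightarrow> (\<forall>k<n. F s' v k = F s v k \<and> G s' v k = G s v k)))"
  unfolding merge_com_def
proof (rule halts_For[where M = n and I = "\<lambda>j s'.
    (\<forall>k<n. n - j \<le> k \<longrightarrow>
      merged_entry \<beta> w (edge e) (F s pv) (G s pv) (F s cv) (G s cv) k (F s' pv k) (G s' pv k)) \<and>
    (\<forall>v<n. \<forall>k<n. v \<noteq> pv \<or> k < n - j \<longrightarrow>
      F s' v k = F s v k \<and> (\<forall>q<m. mult s' q v k = mult s q v k))"])
  let ?inc = "NWrite ''sol'' (sol_at ''e'' ''p'' ''k'')
        (NAdd (NRead ''sol'' (sol_at ''e'' ''p'' ''k'')) (Var ''d''))"
  let ?B = "Seq (NWrite ''k'' (NConst 0) (NSub (NSub (Var ''n'') (NConst 1)) (Var ''j'')))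
    (Seq (RWrite ''best'' (NConst 0) (RAdd (RVar ''beta'') ROne))
    (Seq (NWrite ''a'' (NConst 0) (NConst 0))
    (Seq (NWrite ''b'' (NConst 0) (NConst 0))
    (Seq (NWrite ''d'' (NConst 0) (NConst 0))
    (Seq best_com
    (Seq (RWrite ''f'' (NAdd (Var ''p'') (Var ''k'')) (RVar ''best''))
    (Seq copy_com ?inc)))))))"
  let ?P = "For ''j'' (Var ''n'') ?B"
  let ?entry = "merged_entry \<beta> w (edge e) (F s pv) (G s pv) (F s cv) (G s cv)"
  let ?I = "\<lambda>j s'. (\<forall>k<n. n - j \<le> k \<longrightarrow> ?entry k (F s' pv k) (G s' pv k)) \<and>
    (\<forall>v<n. \<forall>k<n. v \<noteq> pv \<or> k < n - j \<longrightarrow>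
      F s' v k = F s v k \<and> (\<forall>q<m. mult s' q v k = mult s q v k))"
  fix s' assume s': "agree ?P s s'"
  have ld': "loaded s'" by (rule loaded_agree[OF s' ld]) auto
  have ad': "addressed s'" by (rule addressed_agree[OF s' ad]) auto
  have vars': "nats s' ''p'' 0 = pv * n" "nats s' ''c'' 0 = cv * n" "nats s' ''e'' 0 = e"
      "\<And>b. reals s' ''w'' (of_bool b) = w b"
    using vars agreeD(1)[OF s', of "''p''"] agreeD(1)[OF s', of "''c''"] agreeD(1)[OF s', of "''e''"]
      agreeD(2)[OF s', of "''w''"] by simp_all
  show "nval (Var ''n'') s' = n" using ld' by (simp add: loadedD)
  show "(\<forall>k<n. ?entry k (F s' pv k) (G s' pv k)) \<and>
      (\<forall>v<n. v \<noteq> pv \<longrightarrow> (\<forall>k<n. F s' v k = F s v k \<and> G s' v k = G s v k))" if "?I n s'"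
    using that G_cong[of s' _ _ s] by simp
  fix j assume j: "j < n" "nats s' ''j'' 0 = j" and I: "?I j s'"
  define k where "k = n - 1 - j"
  have k: "k < n" "k < n - j" using j by (auto simp: k_def)
  have old: "F s' pv i = F s pv i" "F s' cv i = F s cv i" "q < m \<Longrightarrow> mult s' q pv i = mult s q pv i"
      "q < m \<Longrightarrow> mult s' q cv i = mult s q cv i" if "i \<le> k" for i q
    using I that k bounds by auto
  define s1 where "s1 = nwrite ''d'' 0 0 (nwrite ''b'' 0 0 (nwrite ''a'' 0 0
    (rwrite ''best'' 0 (\<beta> + 1) (nwrite ''k'' 0 k s'))))"
  have s1: "loaded s1" "addressed s1" "nats s1 ''k'' 0 = k" "nats s1 ''p'' 0 = pv * n"
      "nats s1 ''c'' 0 = cv * n" "nats s1 ''e'' 0 = e" "F s1 = F s'" "mult s1 = mult s'"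
    using ld' ad' vars' by (simp_all add: s1_def loaded_def addressed_def)
  have op: "operands w (F s pv) (F s cv) k s1"
    unfolding operands_def
  proof (intro conjI allI impI)
    fix i assume "i \<le> k"
    then show "reals s1 ''f'' (nats s1 ''p'' 0 + i) = F s pv i"
      "reals s1 ''f'' (nats s1 ''c'' 0 + i) = F s cv i" "0 \<le> F s pv i"
      using old nonneg k s1 by (simp_all add: F_def[symmetric])
  qed (use s1 vars' in \<open>auto simp: s1_def loadedD[OF ld']\<close>)
  \<comment> \<open>Since \<beta> + 1 exceeds \<beta>, the clause that asks for a witness is
    vacuous.\<close>
  have start: "best_in w (F s pv) (F s cv) k (\<lambda>_ _. False) s1"
    using \<beta> by (simp add: best_in_def best_of_def s1_def)
  have rest: "halts n ?inc s4 (\<lambda>s''. ?I (Suc j) (nwrite ''j'' 0 (Suc j) s''))"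
    if s2: "agree best_com s1 s2" "best_in w (F s pv) (F s cv) k (\<lambda>_ _. True) s2"
      and s4: "agree copy_com (rwrite ''f'' (pv * n + k) (reals s2 ''best'' 0) s2) s4"
        "\<forall>q<m. \<forall>v<n. \<forall>l<n. mult s4 q v l =
          (if v = pv \<and> l = k then mult s2 q pv (nats s2 ''a'' 0) + mult s2 q cv (nats s2 ''b'' 0)
           else mult s2 q v l)" for s2 s4
  proof -
    let ?i = "nats s2 ''a'' 0" and ?j = "nats s2 ''b'' 0" and ?d = "nats s2 ''d'' 0"
      and ?x = "reals s2 ''best'' 0"
    let ?s3 = "rwrite ''f'' (pv * n + k) ?x s2"
    have ij: "?i \<le> k" "?j \<le> k" using s2(2) by (auto simp: best_in_def best_of_def)
    have m2: "mult s2 = mult s'" using mult_agree[OF s2(1)] s1 by simp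
    have F4: "F s4 v l = (if v = pv \<and> l = k then ?x else F s' v l)" if "l < n" for v l
      using F_agree[OF s4(1)] F_agree[OF s2(1)] s1 k that by simp
    have eq: "nats s4 a = nats s1 a" if "a \<in> {''p'', ''k'', ''e'', ''block''}" for a
      using that agreeD(1)[OF s4(1), of a] agreeD(1)[OF s2(1), of a] by auto
    have d4: "nats s4 ''d'' 0 = ?d" using agreeD(1)[OF s4(1), of "''d''"] by simp
    have m4: "mult s4 q v l = (if v = pv \<and> l = k then mult s q pv ?i + mult s q cv ?j
        else mult s' q v l)" if "q < m" "v < n" "l < n" for q v l
      using s4(2) that old ij by (simp add: m2)
    have blk: "nats s1 ''block'' e = e * (n * n)" using addressedD(2)[OF s1(2), of e] bounds m_less by simp
    have addr: "nval (sol_at ''e'' ''p'' ''k'') s4 = e * (n * n) + (pv * n + k)"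
      using eq s1 blk by (simp add: sol_at_def)
    let ?s5 = "nwrite ''sol'' (e * (n * n) + (pv * n + k)) (mult s4 e pv k + ?d) s4"
    let ?s6 = "nwrite ''j'' 0 (Suc j) ?s5"
    have F6: "F ?s6 v l = (if v = pv \<and> l = k then ?x else F s' v l)" if "l < n" for v l
      using F4[OF that] by simp
    have m6: "mult ?s6 q v l = (if v = pv \<and> l = k
        then mult s q pv ?i + mult s q cv ?j + (if q = e then ?d else 0) else mult s' q v l)"
      if "q < m" "v < n" "l < n" for q v l
      using m4 that bounds k by simp
    have "?entry k (F ?s6 pv k) (G ?s6 pv k)"
    proof -
      have best: "0 \<le> ?x" "\<forall>i j b. candidate \<beta> w (F s pv) (F s cv) k i j b \<longrightarrow>
          ?x \<le> max (F s pv i) (F s cv j + w b)"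
        "?x \<le> \<beta> \<longrightarrow> (\<exists>b. candidate \<beta> w (F s pv) (F s cv) k ?i ?j b \<and>
          ?x = max (F s pv ?i) (F s cv ?j + w b) \<and> ?d = of_bool b)"
        using s2(2) unfolding best_in_def best_of_def by blast+
      have "G ?s6 pv k = G s pv ?i \<union> G s cv ?j \<union> (if b then {edge e} else {})" if "?d = of_bool b" for b
      proof -
        \<comment> \<open>A sum of naturals vanishes only if all summands do, so supports unite; the
          final increment adds \<open>e\<close> exactly if the edge is contracted.\<close>
        have "{q. q < m \<and> mult ?s6 q pv k \<noteq> 0} = {q. q < m \<and> mult s q pv ?i \<noteq> 0} \<union>
            {q. q < m \<and> mult s q cv ?j \<noteq> 0} \<union> (if b then {e} else {})"
          using m6[OF _ bounds(1) k(1)] that bounds(4)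
          by (cases b) (auto split: if_splits)
        then show ?thesis unfolding G_def by (simp add: image_Un)
      qed
      moreover have "F ?s6 pv k = ?x" using F6[OF k(1)] by simp
      ultimately show ?thesis unfolding merged_entry_def using best by metis
    qed
    moreover have "?entry l (F ?s6 pv l) (G ?s6 pv l)" if "l < n" "n - j \<le> l" for l
    proof -
      have "l \<noteq> k" using that k by simp
      then have "F ?s6 pv l = F s' pv l" "G ?s6 pv l = G s' pv l"
        using F6 m6 that bounds by (auto intro!: G_cong)
      then show ?thesis using I that by simp
    qed
    moreover have "n - Suc j \<le> l \<longleftrightarrow> n - j \<le> l \<or> l = k" for l using j by (auto simp: k_def)
    ultimately have "\<forall>l<n. n - Suc j \<le> l \<longrightarrow> ?entry l (F ?s6 pv l) (G ?s6 pv l)" by blast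
    moreover have "\<forall>v<n. \<forall>l<n. v \<noteq> pv \<or> l < n - Suc j \<longrightarrow>
      F ?s6 v l = F s v l \<and> (\<forall>q<m. mult ?s6 q v l = mult s q v l)"
    proof (intro allI impI)
      fix v l assume vl: "v < n" "l < n" "v \<noteq> pv \<or> l < n - Suc j"
      then have "v \<noteq> pv \<or> l \<noteq> k" "v \<noteq> pv \<or> l < n - j" by (auto simp: k_def)
      then show "F ?s6 v l = F s v l \<and> (\<forall>q<m. mult ?s6 q v l = mult s q v l)"
        using I vl F6 m6 by auto
    qed
    ultimately have I6: "?I (Suc j) ?s6" by blast
    show ?thesis
    proof (rule halts_NWriteI[where j = "e * (n * n) + (pv * n + k)" and k = "mult s4 e pv k + ?d"])
      show "nval (sol_at ''e'' ''p'' ''k'') s4 = e * (n * n) + (pv * n + k)" by (rule addr)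
      show "?I (Suc j) ?s6" by (rule I6)
      show "nval (NAdd (NRead ''sol'' (sol_at ''e'' ''p'' ''k'')) (Var ''d'')) s4 = mult s4 e pv k + ?d"
        using addr d4 by (simp add: mult_def)
    qed
  qed
  have tail: "halts n (Seq best_com
    (Seq (RWrite ''f'' (NAdd (Var ''p'') (Var ''k'')) (RVar ''best''))
    (Seq copy_com ?inc))) s1 (\<lambda>s''. ?I (Suc j) (nwrite ''j'' 0 (Suc j) s''))"
  proof (rule halts_Seq, rule halts_use[OF best_com[OF op start k(1)]])
    fix s2 assume s2: "agree best_com s1 s2" "best_in w (F s pv) (F s cv) k (\<lambda>_ _. True) s2"
    have v2: "nats s2 ''p'' 0 = pv * n" "nats s2 ''c'' 0 = cv * n" "nats s2 ''k'' 0 = k"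
      using s1 agreeD(1)[OF s2(1), of "''p''"] agreeD(1)[OF s2(1), of "''c''"]
        agreeD(1)[OF s2(1), of "''k''"] by simp_all
    have "loaded s2" by (rule loaded_agree[OF s2(1) s1(1)]) auto
    moreover have "addressed s2" by (rule addressed_agree[OF s2(1) s1(2)]) auto
    moreover have ij: "nats s2 ''a'' 0 < n" "nats s2 ''b'' 0 < n"
      using s2(2) k by (auto simp: best_in_def best_of_def)
    let ?s3 = "rwrite ''f'' (pv * n + k) (reals s2 ''best'' 0) s2"
    have "loaded ?s3" "addressed ?s3"
      using \<open>loaded s2\<close> \<open>addressed s2\<close> by (simp_all add: loaded_def addressed_def)
    note copy = copy_com[OF this bounds(1,2) k(1) ij, simplified, OF v2]
    show "halts n (Seq (RWrite ''f'' (NAdd (Var ''p'') (Var ''k'')) (RVar ''best''))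
        (Seq copy_com ?inc)) s2 (\<lambda>s''. ?I (Suc j) (nwrite ''j'' 0 (Suc j) s''))"
      apply (rule halts_Seq, rule halts_RWriteI[where j = "pv * n + k" and y = "reals s2 ''best'' 0"])
        apply (simp add: v2)
       apply simp
      apply (rule halts_Seq, rule halts_use[OF copy])
      by (rule rest[OF s2]) simp_all
  qed
  show "halts n ?B s' (\<lambda>s''. ?I (Suc j) (nwrite ''j'' 0 (Suc j) s''))"
    apply (rule halts_Seq, rule halts_NWriteI[where k = k], simp, simp add: k_def j loadedD[OF ld'])
    apply (rule halts_Seq, rule halts_RWriteI[where y = "\<beta> + 1"], simp, simp add: loadedD[OF ld'])
    apply (rule halts_Seq, rule halts_NWriteI[where k = 0], simp, simp)
    apply (rule halts_Seq, rule halts_NWriteI[where k = 0], simp, simp)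
    apply (rule halts_Seq, rule halts_NWriteI[where k = 0], simp, simp)
    using tail by (simp add: s1_def)
qed (auto simp: F_def)

subsection \<open>Absorbing all leaves\<close>

abbreviation feasible :: "nat set set \<Rightarrow> bool" where
  "feasible \<equiv> is_contraction (\<lambda>x. x / \<alpha> - \<beta>) {..<n} E len"

text \<open>\<open>S\<close> and \<open>B\<close> are ghosts, present in no cell of the memory. By
  the last clause nothing feasible is lost or gained as leaves disappear; by the second one the
  table keeps a best representative per cardinality.\<close>

definition tabulated :: "state \<Rightarrow> (nat \<times> nat) list \<Rightarrow> bool" where
  "tabulated s xs \<longleftrightarrow> (\<exists>S B. pending \<beta> 0 xs S B \<and>
     (\<forall>v\<in>verts 0 xs. tabulates \<beta> n (S v) (F s v) (G s v)) \<and>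
     (\<forall>C. completes \<beta> (charge \<alpha> len) 0 xs S B C \<longleftrightarrow> feasible C))"

lemma tabulated_start:
  assumes "grown 0 xs" "verts 0 xs = {..<n}" "edges xs = E"
    and F: "\<forall>v<n. \<forall>k<n. F s v k = (if k = 0 then 0 else \<beta> + 1)" and G: "nats s ''sol'' = (\<lambda>_. 0)"
  shows "tabulated s xs"
  unfolding tabulated_def
proof (intro exI conjI ballI allI)
  show "pending \<beta> 0 xs (\<lambda>_. {({}, 0)}) (\<lambda>_. {})" using \<beta> by (simp add: pending_def)
  show "tabulates \<beta> n {({}, 0)} (F s v) (G s v)" if "v \<in> verts 0 xs" for v
    using F G \<beta> that assms(2) by (auto simp: tabulates_def G_def mult_def)
  show "completes \<beta> (charge \<alpha> len) 0 xs (\<lambda>_. {({}, 0)}) (\<lambda>_. {}) C \<longleftrightarrow> feasible C" for C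
    using completes_start[OF assms(1) \<beta>] assms(2,3) by simp
qed

lemma tabulated_step:
  assumes "grown 0 ((p, c) # xs)" "verts 0 ((p, c) # xs) \<subseteq> {..<n}" "tabulated s ((p, c) # xs)"
    and new: "\<forall>k<n. merged_entry \<beta> (charge \<alpha> len {p, c}) {p, c} (F s p) (G s p) (F s c) (G s c) k
      (F s' p k) (G s' p k)"
    and old: "\<forall>v<n. v \<noteq> p \<longrightarrow> (\<forall>k<n. F s' v k = F s v k \<and> G s' v k = G s v k)"
  shows "tabulated s' xs"
proof -
  obtain S B where S: "pending \<beta> 0 ((p, c) # xs) S B"
      "\<forall>v\<in>verts 0 ((p, c) # xs). tabulates \<beta> n (S v) (F s v) (G s v)"
      "\<forall>C. completes \<beta> (charge \<alpha> len) 0 ((p, c) # xs) S B C \<longleftrightarrow> feasible C"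
    using assms(3) unfolding tabulated_def by blast
  let ?S = "S(p := merge \<beta> (charge \<alpha> len {p, c}) {p, c} (S p) (S c))"
    and ?B = "B(p := B p \<union> B c \<union> {{p, c}})"
  have pc: "p \<in> verts 0 ((p, c) # xs)" "c \<in> verts 0 ((p, c) # xs)" "p \<noteq> c"
    using assms(1) by auto
  note P = pendingD[OF S(1) pc(1)] and C = pendingD[OF S(1) pc(2)]
  have "tabulates \<beta> n (?S v) (F s' v) (G s' v)" if v: "v \<in> verts 0 xs" for v
  proof (cases "v = p")
    case True
    have "tabulates \<beta> n (merge \<beta> (charge \<alpha> len {p, c}) {p, c} (S p) (S c)) (F s' p) (G s' p)"
    proof (rule tabulates_merge[where P = "B p" and Q = "B c"])
      show "\<forall>(A, x)\<in>S p. A \<subseteq> B p \<and> 0 \<le> x \<and> x \<le> \<beta>" using P(4-6) by blast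
      show "\<forall>(A, x)\<in>S c. A \<subseteq> B c \<and> 0 \<le> x \<and> x \<le> \<beta>" using C(4-6) by blast
      show "B p \<inter> B c = {}" using C(3)[OF pc(1) pc(3)] .
      show "{p, c} \<notin> B p" "{p, c} \<notin> B c" using P(2) C(2) by auto
    qed (use S(2) pc P(1) C(1) new in auto)
    then show ?thesis using True by simp
  next
    case False
    have "F s' v k = F s v k \<and> G s' v k = G s v k" if "k < n" for k
      using old False v assms(2) that by auto
    moreover have "tabulates \<beta> n (S v) (F s v) (G s v)" using S(2) v by simp
    ultimately show ?thesis using False by (simp add: tabulates_def)
  qed
  moreover have "pending \<beta> 0 xs ?S ?B" by (rule pending_step[OF assms(1) S(1)])
  moreover have "\<forall>C. completes \<beta> (charge \<alpha> len) 0 xs ?S ?B C \<longleftrightarrow> feasible C"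
    using completes_step[OF assms(1) S(1)] S(3) by blast
  ultimately show ?thesis unfolding tabulated_def by blast
qed

lemma grows_prefix:
  assumes "grows i s" "j \<le> i"
  shows "grown 0 (grown_list s j)" "verts 0 (grown_list s j) \<subseteq> {..<n}"
proof -
  have "grown 0 (grown_list s j) \<and> verts 0 (grown_list s j) \<subseteq> {..<n}"
    using assms(2)
  proof (induction j rule: inc_induct)
    case base
    then show ?case using assms(1) by (simp add: grows_def)
  qed auto
  then show "grown 0 (grown_list s j)" "verts 0 (grown_list s j) \<subseteq> {..<n}" by auto
qed

lemma absorb_com:
  assumes ld: "loaded s" and ad: "addressed s" and gr: "grows (n - 1) s"
    and tab: "tabulated s (grown_list s (n - 1))"
  shows "halts n absorb_com s (\<lambda>s'. tabulated s' [])"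
  unfolding absorb_com_def
proof (rule halts_For[where M = "n - 1" and I = "\<lambda>i s'. tabulated s' (grown_list s (n - 1 - i))"])
  let ?B = "Seq (NWrite ''r'' (NConst 0) (NSub (NSub (Var ''n'') (NConst 2)) (Var ''i'')))
    (Seq (NWrite ''p'' (NConst 0) (NRead ''row'' (NRead ''par'' (Var ''r''))))
    (Seq (NWrite ''c'' (NConst 0) (NRead ''row'' (NRead ''chd'' (Var ''r''))))
    (Seq (NWrite ''e'' (NConst 0) (NRead ''ord'' (Var ''r'')))
    (Seq (RWrite ''w'' (NConst 1) (RDiv (RRead ''len'' (Var ''e'')) (RVar ''alpha'')))
    (Seq (RWrite ''w'' (NConst 0) (RSub (RRead ''w'' (NConst 1)) (RRead ''len'' (Var ''e''))))
      merge_com)))))"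
  let ?P = "For ''i'' (NSub (Var ''n'') (NConst 1)) ?B"
  have tabulated_write: "tabulated s' xs = tabulated s'' xs" if "F s' = F s''" "mult s' = mult s''"
    for s' s'' xs
  proof -
    have "G s' = G s''" using that(2) by (simp add: G_def fun_eq_iff)
    then show ?thesis using that(1) by (simp add: tabulated_def)
  qed
  show "tabulated (nwrite ''i'' 0 0 s) (grown_list s (n - 1 - 0))"
    using tab tabulated_write[of s "nwrite ''i'' 0 0 s"] by simp
  fix s' assume s': "agree ?P s s'"
  have ld': "loaded s'" by (rule loaded_agree[OF s' ld]) auto
  have ad': "addressed s'" by (rule addressed_agree[OF s' ad]) auto
  have ord: "nats s' ''par'' = nats s ''par''" "nats s' ''chd'' = nats s ''chd''"
      "nats s' ''ord'' = nats s ''ord''"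
    using agreeD(1)[OF s', of "''par''"] agreeD(1)[OF s', of "''chd''"]
      agreeD(1)[OF s', of "''ord''"] by simp_all
  show "nval (NSub (Var ''n'') (NConst 1)) s' = n - 1" using ld' by (simp add: loadedD)
  show "tabulated s' (grown_list s (n - 1 - (n - 1))) \<Longrightarrow> tabulated s' []" by simp
  fix i assume i: "i < n - 1" "nats s' ''i'' 0 = i" and I: "tabulated s' (grown_list s (n - 1 - i))"
  \<comment> \<open>The last of the \<open>n - 1\<close> slots has index \<open>n - 2\<close>; round
    \<open>i\<close> removes the head of a list of length \<open>Suc r\<close>.\<close>
  define r where "r = n - 2 - i"
  have r: "n - 1 - i = Suc r" "n - 1 - Suc i = r" "r < n - 1" using i by (auto simp: r_def)
  define p c e where "p = nats s ''par'' r" and "c = nats s ''chd'' r" and "e = nats s ''ord'' r"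
  let ?xs = "grown_list s r"
  have e: "e < m" "edge e = {p, c}" using gr r(3) by (auto simp: grows_def p_def c_def e_def)
  have g: "grown 0 ((p, c) # ?xs)" "verts 0 ((p, c) # ?xs) \<subseteq> {..<n}"
    using grows_prefix[OF gr, of "Suc r"] r(3) by (auto simp: p_def c_def)
  then have pc: "p < n" "c < n" "p \<noteq> c" by auto
  define s1 where "s1 = rwrite ''w'' 0 (len (edge e) / \<alpha> - len (edge e))
    (rwrite ''w'' 1 (len (edge e) / \<alpha>) (nwrite ''e'' 0 e (nwrite ''c'' 0 (c * n)
      (nwrite ''p'' 0 (p * n) (nwrite ''r'' 0 r s')))))"
  have s1: "loaded s1" "addressed s1" "nats s1 ''p'' 0 = p * n" "nats s1 ''c'' 0 = c * n"
      "nats s1 ''e'' 0 = e" "F s1 = F s'" "mult s1 = mult s'"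
    using ld' ad' by (simp_all add: s1_def loaded_def addressed_def)
  have w: "reals s1 ''w'' (of_bool b) = charge \<alpha> len {p, c} b" for b
    using e by (cases b) (simp_all add: s1_def charge_def)
  have tab1: "tabulated s1 ((p, c) # ?xs)"
    using I r tabulated_write[OF s1(6,7)] by (simp add: p_def c_def)
  have "tabulates \<beta> n (S v) (F s1 v) (G s1 v) \<Longrightarrow> k < n \<Longrightarrow> 0 \<le> F s1 v k" for S v k
    by (simp add: tabulates_def)
  then have nonneg: "0 \<le> F s1 p k" if "k < n" for k
    using tab1 g(1) that unfolding tabulated_def by fastforce
  have tail: "halts n merge_com s1
      (\<lambda>s''. tabulated (nwrite ''i'' 0 (Suc i) s'') (grown_list s (n - 1 - Suc i)))"
  proof (rule halts_mono[OF merge_com[OF s1(1,2) pc e(1) s1(3-5) w nonneg]])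
    fix u assume u: "(\<forall>k<n. merged_entry \<beta> (charge \<alpha> len {p, c}) (edge e) (F s1 p) (G s1 p) (F s1 c)
        (G s1 c) k (F u p k) (G u p k)) \<and>
      (\<forall>v<n. v \<noteq> p \<longrightarrow> (\<forall>k<n. F u v k = F s1 v k \<and> G u v k = G s1 v k))"
    have "tabulated u ?xs" using tabulated_step[OF g tab1, of u] u e(2) by simp
    then show "tabulated (nwrite ''i'' 0 (Suc i) u) (grown_list s (n - 1 - Suc i))"
      using r tabulated_write[of u "nwrite ''i'' 0 (Suc i) u"] by simp
  qed
  show "halts n ?B s' (\<lambda>s''. tabulated (nwrite ''i'' 0 (Suc i) s'') (grown_list s (n - 1 - Suc i)))"
    apply (rule halts_Seq, rule halts_NWriteI[where k = r], simp, simp add: r_def i loadedD[OF ld'])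
    apply (rule halts_Seq, rule halts_NWriteI[where k = "p * n"], simp,
        simp add: ord p_def[symmetric] pc less_imp_le addressedD[OF ad'])
    apply (rule halts_Seq, rule halts_NWriteI[where k = "c * n"], simp,
        simp add: ord c_def[symmetric] pc less_imp_le addressedD[OF ad'])
    apply (rule halts_Seq, rule halts_NWriteI[where k = e], simp, simp add: ord e_def)
    apply (rule halts_Seq, rule halts_RWriteI[where y = "len (edge e) / \<alpha>"], simp,
        simp add: e loadedD[OF ld'])
    apply (rule halts_Seq, rule halts_RWriteI[where y = "len (edge e) / \<alpha> - len (edge e)"], simp,
        simp add: e loadedD[OF ld'])
    using tail by (simp add: s1_def)
qed auto

subsection \<open>Selecting an optimal solution\<close>

definition optimal_index :: "state \<Rightarrow> nat \<Rightarrow> bool" where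
  "optimal_index s k \<longleftrightarrow> k < n \<and> F s 0 k \<le> \<beta> \<and> (\<forall>k'<n. F s 0 k' \<le> \<beta> \<longrightarrow> k' \<le> k)"

lemma select_com:
  assumes ld: "loaded s" and ex: "\<exists>k<n. F s 0 k \<le> \<beta>"
  shows "halts n select_com s (\<lambda>s'. optimal_index s (nats s' ''a'' 0))"
  unfolding select_com_def
\<comment> \<open>Until a feasible entry is met, \<open>''a''\<close> still holds what merging left
  there, so the invariant is conditional.\<close>
proof (rule halts_For[where M = n and I = "\<lambda>i s'. (\<exists>k<i. F s 0 k \<le> \<beta>) \<longrightarrow> nats s' ''a'' 0 < i \<and>
    F s 0 (nats s' ''a'' 0) \<le> \<beta> \<and> (\<forall>k<i. F s 0 k \<le> \<beta> \<longrightarrow> k \<le> nats s' ''a'' 0)"])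
  let ?B = "Cond (RLess (RVar ''beta'') (RRead ''f'' (Var ''k''))) Skip (NWrite ''a'' (NConst 0) (Var ''k''))"
  let ?P = "For ''k'' (Var ''n'') ?B"
  fix s' assume s': "agree ?P s s'"
  have ld': "loaded s'" by (rule loaded_agree[OF s' ld]) auto
  have F: "reals s' ''f'' k = F s 0 k" for k using agreeD(2)[OF s', of "''f''"] by (simp add: F_def)
  show "nval (Var ''n'') s' = n" using ld' by (simp add: loadedD)
  let ?I = "\<lambda>i s'. (\<exists>k<i. F s 0 k \<le> \<beta>) \<longrightarrow> nats s' ''a'' 0 < i \<and>
    F s 0 (nats s' ''a'' 0) \<le> \<beta> \<and> (\<forall>k<i. F s 0 k \<le> \<beta> \<longrightarrow> k \<le> nats s' ''a'' 0)"
  show "optimal_index s (nats s' ''a'' 0)" if "?I n s'"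
    using that ex by (auto simp: optimal_index_def)
  fix i assume i: "nats s' ''k'' 0 = i" and I: "?I i s'"
  show "halts n ?B s' (\<lambda>s''. ?I (Suc i) (nwrite ''k'' 0 (Suc i) s''))"
    using i I by (intro halts_intros) (auto simp: loadedD[OF ld'] F less_Suc_eq)
qed auto

lemma output_com:
  assumes ld: "loaded s" and ad: "addressed s" and a: "nats s ''a'' 0 = k"
  shows "halts n output_com s (\<lambda>s'. output_edges es s' = G s 0 k)"
  unfolding output_com_def
proof (rule halts_For[where M = m and I = "\<lambda>i s'. \<forall>q<i. nats s' ''out'' q = mult s q 0 k"])
  let ?B = "NWrite ''out'' (Var ''q'') (NRead ''sol'' (NAdd (NRead ''block'' (Var ''q'')) (Var ''a'')))"
  let ?P = "For ''q'' (Var ''m'') ?B"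
  fix s' assume s': "agree ?P s s'"
  have ld': "loaded s'" by (rule loaded_agree[OF s' ld]) auto
  have ad': "addressed s'" by (rule addressed_agree[OF s' ad]) auto
  have eq: "nats s' ''sol'' = nats s ''sol''" "nats s' ''a'' 0 = k"
    using agreeD(1)[OF s', of "''sol''"] agreeD(1)[OF s', of "''a''"] a by simp_all
  show "nval (Var ''m'') s' = m" using ld' by (simp add: loadedD)
  show "output_edges es s' = G s 0 k" if "\<forall>q<m. nats s' ''out'' q = mult s q 0 k"
    using that by (auto simp: output_edges_def G_def edge_def)
  fix i assume i: "i < m" "nats s' ''q'' 0 = i" and I: "\<forall>q<i. nats s' ''out'' q = mult s q 0 k"
  have "nats s' ''block'' i = i * (n * n)" using addressedD(2)[OF ad', of i] i(1) m_less by simp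
  then show "halts n ?B s' (\<lambda>s''. \<forall>q<Suc i. nats (nwrite ''q'' 0 (Suc i) s'') ''out'' q = mult s q 0 k)"
    using i I eq by (intro halts_NWrite) (auto simp: mult_def less_Suc_eq)
qed (use m_less in auto)

text \<open>Nothing contracted leaves all distances \<open>x \<ge> 0\<close> unchanged, and
  \<open>x / \<alpha> - \<beta> \<le> x\<close>. This guarantees that the selection finds an
  entry.\<close>

lemma feasible_empty: "feasible {}"
proof -
  have dist: "0 \<le> graph_dist {..<n} E len u v" if "u < n" "v < n" for u v
    unfolding graph_dist_def
  proof (rule cINF_greatest)
    show "paths_between {..<n} E u v \<noteq> {}" using tree that by (auto simp: is_tree_def is_connected_def)
    have nonneg: "successively (\<lambda>u v. {u, v} \<in> E) p \<Longrightarrow> 0 \<le> path_length len p" for p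
    proof (induction p rule: induct_list012)
      case (3 x y zs)
      then show ?case using len_pos by (auto intro: add_nonneg_nonneg less_imp_le)
    qed (simp_all add: path_length_def)
    show "0 \<le> path_length len p" if "p \<in> paths_between {..<n} E u v" for p
      using that by (auto simp: paths_between_def is_path_def intro: nonneg)
  qed
  have "x / \<alpha> - \<beta> \<le> x" if "0 \<le> x" for x
  proof -
    have "x / \<alpha> \<le> x / 1" using that \<alpha> by (intro divide_left_mono) auto
    then show ?thesis using \<beta> by simp
  qed
  moreover have "zero_on {} len = len" by (simp add: zero_on_def fun_eq_iff)
  ultimately show ?thesis using dist by (simp add: is_contraction_def)
qed

text \<open>Once only the root is left, its partial solutions are exactly the feasible sets. None
  has \<open>n\<close> or more edges, so the row of the root covers all cardinalities, and the
  largest index with an entry up to \<beta> is the optimum.\<close>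

lemma tabulated_optimal:
  assumes "tabulated s []" "optimal_index s k" "grows (n - 1) u"
  shows "optimal_contraction (\<lambda>x. x / \<alpha> - \<beta>) {..<n} E len (G s 0 k)"
proof -
  let ?xs = "grown_list u (n - 1)"
  have xs: "grown 0 ?xs" "verts 0 ?xs = {..<n}" "edges ?xs = E"
    using assms(3) grows_all[OF assms(3)] by (auto simp: grows_def)
  obtain S B where S: "pending \<beta> 0 [] S B" "tabulates \<beta> n (S 0) (F s 0) (G s 0)"
      "\<And>C. (\<exists>x. (C, x) \<in> S 0) \<longleftrightarrow> feasible C"
    using assms(1) completes_finish unfolding tabulated_def by (metis insertI1 verts_simps(1))
  have sub: "C \<subseteq> E" if "feasible C" for C using that by (simp add: is_contraction_def)
  have fin: "finite E" using xs(3) finite_edges by metis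
  have E: "card E < n" using tree_card_edges[OF tree] by simp
  have "x \<le> \<beta> \<and> card A < n" if "(A, x) \<in> S 0" for A x
  proof -
    have "A \<subseteq> E" using S(3) sub that by blast
    then have "card A \<le> card E" using fin card_mono by blast
    then show ?thesis using pendingD(6)[OF S(1), of 0] that E by auto
  qed
  then have "\<forall>(A, x)\<in>S 0. x \<le> \<beta> \<and> card A < n" by blast
  note opt = tabulates_optimal[OF S(2) _ _ _ this, of k]
  have k: "k < n" "F s 0 k \<le> \<beta>" "\<And>k'. k' < n \<Longrightarrow> F s 0 k' \<le> \<beta> \<Longrightarrow> k' \<le> k"
    using assms(2) by (auto simp: optimal_index_def)
  have "feasible (G s 0 k)" using opt(1)[OF k] S(3) by blast
  moreover have "card C \<le> card (G s 0 k)" if "feasible C" for C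
    using opt(2)[OF k] S(3) that by blast
  moreover have "contraction_value E C = int (card C)" if "feasible C" for C
    using contraction_value_grown[OF xs(1), of C] xs(3) sub[OF that] by simp
  ultimately show ?thesis by (simp add: optimal_contraction_def)
qed

lemma tabulated_feasible:
  assumes "tabulated s []"
  shows "F s 0 0 \<le> \<beta>"
proof -
  obtain S B where S: "pending \<beta> 0 [] S B" "tabulates \<beta> n (S 0) (F s 0) (G s 0)"
      "\<And>C. (\<exists>x. (C, x) \<in> S 0) \<longleftrightarrow> feasible C"
    using assms(1) completes_finish unfolding tabulated_def by (metis insertI1 verts_simps(1))
  then obtain x where x: "({}, x) \<in> S 0" using feasible_empty by blast
  then have "F s 0 0 \<le> x" using S(2) m_less by (force simp: tabulates_def)
  also have "x \<le> \<beta>" using pendingD(6)[OF S(1) _ x] by simp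
  finally show ?thesis .
qed

lemma contraction_com:
  "halts n contraction_com (input_state n es len \<alpha> \<beta>)
    (\<lambda>s. optimal_contraction (\<lambda>x. x / \<alpha> - \<beta>) {..<n} E len (output_edges es s))"
  unfolding contraction_com_def
proof -
  let ?s = "input_state n es len \<alpha> \<beta>"
  let ?Q = "\<lambda>s. optimal_contraction (\<lambda>x. x / \<alpha> - \<beta>) {..<n} E len (output_edges es s)"
  have init: "loaded ?s" "nats ?s ''row'' 0 = 0" "nats ?s ''block'' 0 = 0" "reals ?s ''f'' = (\<lambda>_. 0)"
      "nats ?s ''mark'' = (\<lambda>_. 0)" "nats ?s ''sol'' = (\<lambda>_. 0)"
    by (auto simp: input_state_def loaded_def edge_def)
  show "halts n (Seq address_com (Seq start_com (Seq grow_com (Seq absorb_com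
      (Seq select_com output_com))))) ?s ?Q"
  proof (rule halts_Seq, rule halts_use[OF address_com[OF init(1-3)]])
    fix s1 assume s1: "agree address_com ?s s1" "addressed s1"
    have l1: "loaded s1" by (rule loaded_agree[OF s1(1) init(1)]) auto
    have i1: "reals s1 ''f'' = (\<lambda>_. 0)" "nats s1 ''mark'' = (\<lambda>_. 0)" "nats s1 ''sol'' = (\<lambda>_. 0)"
      using agreeD(2)[OF s1(1), of "''f''"] agreeD(1)[OF s1(1), of "''mark''"]
        agreeD(1)[OF s1(1), of "''sol''"] init by simp_all
    show "halts n (Seq start_com (Seq grow_com (Seq absorb_com (Seq select_com output_com)))) s1 ?Q"
    proof (rule halts_Seq, rule halts_use[OF start_com[OF l1 s1(2) i1(1)]])
      fix s2 assume s2: "agree start_com s1 s2"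
        and F2: "\<forall>v<n. \<forall>k<n. F s2 v k = (if k = 0 then 0 else \<beta> + 1)"
      have l2: "loaded s2" "addressed s2"
        by (rule loaded_agree[OF s2 l1] addressed_agree[OF s2 s1(2)]; auto)+
      have i2: "nats s2 ''mark'' = (\<lambda>_. 0)" "nats s2 ''sol'' = (\<lambda>_. 0)"
        using agreeD(1)[OF s2, of "''mark''"] agreeD(1)[OF s2, of "''sol''"] i1 by simp_all
      show "halts n (Seq grow_com (Seq absorb_com (Seq select_com output_com))) s2 ?Q"
      proof (rule halts_Seq, rule halts_use[OF grow_com[OF l2(1) i2(1)]])
        fix s3 assume s3: "agree grow_com s2 s3" "grows (n - 1) s3"
        have l3: "loaded s3" "addressed s3"
          by (rule loaded_agree[OF s3(1) l2(1)] addressed_agree[OF s3(1) l2(2)]; auto)+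
        have "nats s3 ''sol'' = (\<lambda>_. 0)" "F s3 = F s2"
          using agreeD(1)[OF s3(1), of "''sol''"] F_agree[OF s3(1)] i2 by simp_all
        then have tab: "tabulated s3 (grown_list s3 (n - 1))"
          using tabulated_start[OF _ grows_all[OF s3(2)], of s3] s3(2) F2 by (simp add: grows_def)
        show "halts n (Seq absorb_com (Seq select_com output_com)) s3 ?Q"
        proof (rule halts_Seq, rule halts_use[OF absorb_com[OF l3 s3(2) tab]])
          fix s4 assume s4: "agree absorb_com s3 s4" "tabulated s4 []"
          have l4: "loaded s4" "addressed s4"
            by (rule loaded_agree[OF s4(1) l3(1)] addressed_agree[OF s4(1) l3(2)]; auto)+
          have ex: "\<exists>k<n. F s4 0 k \<le> \<beta>" using tabulated_feasible[OF s4(2)] m_less by (intro exI[of _ 0]) simp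
          show "halts n (Seq select_com output_com) s4 ?Q"
          proof (rule halts_Seq, rule halts_use[OF select_com[OF l4(1) ex]])
            fix s5 assume s5: "agree select_com s4 s5" "optimal_index s4 (nats s5 ''a'' 0)"
            have l5: "loaded s5" "addressed s5"
              by (rule loaded_agree[OF s5(1) l4(1)] addressed_agree[OF s5(1) l4(2)]; auto)+
            have "G s5 = G s4" using mult_agree[OF s5(1)] by (simp add: G_def fun_eq_iff)
            then show "halts n output_com s5 ?Q"
              using tabulated_optimal[OF s4(2) s5(2) s3(2)]
              by (intro halts_mono[OF output_com[OF l5 refl]]) simp
          qed
        qed
      qed
    qed
  qed
qed

end

theorem theorem6:
  shows "\<exists>(P :: com) (time :: nat \<Rightarrow> nat).
    (\<lambda>n. real (time n)) \<in> O(\<lambda>n. real n ^ 3) \<and>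
    (\<forall>(n :: nat) (E :: nat set set) (len :: nat set \<Rightarrow> real) (\<alpha> :: real) (\<beta> :: real)
        (es :: (nat \<times> nat) list).
      is_tree {..<n} E \<and> (\<forall>e\<in>E. 0 < len e) \<and> 1 \<le> \<alpha> \<and> 0 \<le> \<beta> \<and> enumerates_edges es E \<longrightarrow>
      (\<exists>t s. runs P (input_state n es len \<alpha> \<beta>) t s \<and> t \<le> time n \<and>
        optimal_contraction (\<lambda>x. x / \<alpha> - \<beta>) {..<n} E len (output_edges es s)))"
proof (intro exI[of _ contraction_com] exI[of _ "\<lambda>n. steps n contraction_com"] conjI allI impI)
  show "(\<lambda>n. real (steps n contraction_com)) \<in> O(\<lambda>n. real n ^ 3)"
    using steps_bigo[of contraction_com] by (simp add: loop_depth_contraction_com)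
  fix n :: nat and E and len :: "nat set \<Rightarrow> real" and \<alpha> \<beta> :: real and es
  assume "is_tree {..<n} E \<and> (\<forall>e\<in>E. 0 < len e) \<and> 1 \<le> \<alpha> \<and> 0 \<le> \<beta> \<and> enumerates_edges es E"
  then interpret tree_instance n E len \<alpha> \<beta> es by unfold_locales auto
  show "\<exists>t s. runs contraction_com (input_state n es len \<alpha> \<beta>) t s \<and> t \<le> steps n contraction_com \<and>
      optimal_contraction (\<lambda>x. x / \<alpha> - \<beta>) {..<n} E len (output_edges es s)"
    using contraction_com unfolding halts_def by blast
qed

end
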